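(* Let $D\subset\mathbb{C}$ be a planar domain and let $p$ be a $\mathcal{C}^{1,1}$-smooth boundary point of $D$. Then $$\limsup_{D\ni z\to p}\left|\alpha_D(z)-\frac{1}{2\delta_D(z)}\right|<\infty,$$ $$\limsup_{D\ni z\to p}\left|\beta_D(z)-\frac{1}{\sqrt2\,\delta_D(z)}\right|<\infty,$$ where $\alpha_D$ is the Carathéodory metric or the Kobayashi metric and $\beta_D$ is the Bergman metric, all taken at the unit vector. Moreover, $$\limsup_{D\ni z\to p}\left|k_D(z)-\frac{1}{2\sqrt\pi\,\delta_D(z)}\right|<\infty.$$
   Context: $\mathbb{D}$ is the unit disc, $\mathcal{O}(A,B)$ is the set of holomorphic maps $A\to B$, and $\delta_D(z)$ is the Euclidean distance from $z$ to $\partial D$. "Taken at the unit vector" means evaluated at $X=1$. The Carathéodory metric is $\gamma_D(z)=\sup\{|f'(z)|:f\in\mathcal{O}(D,\mathbb{D})\}$. The Kobayashi metric is $\kappa_D(z)=\inf\{|t|:\exists\varphi\in\mathcal{O}(\mathbb{D},D):\varphi(0)=z,\ t\varphi'(0)=1\}$. The square root of the Bergman kernel on the diagonal is $$k_D(z)=\sup\{|f(z)|:f\in L^2(D)\cap\mathcal{O}(D),\ \|f\|_{L^2(D)}\le1\}$$ (with respect to Lebesgue measure). The Bergman metric is $\beta_D(z)=m_D(z)/k_D(z)$ with $$m_D(z)=\sup\{|f'(z)|:f\in L^2(D)\cap\mathcal{O}(D),\ \|f\|_{L^2(D)}=1,\ f(z)=0\}.$$ $p\in\partial D$ is a $\mathcal{C}^{1,1}$-smooth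 boundary point if near $p$ the set $D$ is given by $\{\rho<0\}$ for a $\mathcal{C}^{1,1}$ function $\rho$ with $d\rho\ne0$. *)

theory Defs
  imports "HOL-Complex_Analysis.Complex_Analysis"
begin

definition holomorphic_maps :: "complex set \<Rightarrow> complex set \<Rightarrow> (complex \<Rightarrow> complex) set" where
  "holomorphic_maps A B = {f. f holomorphic_on A \<and> f ` A \<subseteq> B}"

definition boundary_dist :: "complex set \<Rightarrow> complex \<Rightarrow> real" where
  "boundary_dist D z = infdist z (frontier D)"

text \<open>
  All metrics are evaluated at the unit vector. The suprema and infima below are taken in the
  type of real numbers. For open \<open>D\<close> and \<open>z \<in> D\<close> the sets involved are bounded on the relevant
  side. They are nonempty, except possibly the one in \<open>bergman_m\<close>, which is nonempty as soon as
  the complement of \<open>D\<close> has interior points.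
\<close>

definition caratheodory_metric :: "complex set \<Rightarrow> complex \<Rightarrow> real" where
  "caratheodory_metric D z = (SUP f \<in> holomorphic_maps D (ball 0 1). cmod (deriv f z))"

definition kobayashi_metric :: "complex set \<Rightarrow> complex \<Rightarrow> real" where
  "kobayashi_metric D z =
     Inf {cmod t |t. \<exists>\<phi> \<in> holomorphic_maps (ball 0 1) D. \<phi> 0 = z \<and> t * deriv \<phi> 0 = 1}"

definition L2_holomorphic :: "complex set \<Rightarrow> (complex \<Rightarrow> complex) set" where
  "L2_holomorphic D =
     {f. f holomorphic_on D \<and> set_integrable lborel D (\<lambda>w. (cmod (f w))\<^sup>2)}"

definition L2_norm_on :: "complex set \<Rightarrow> (complex \<Rightarrow> complex) \<Rightarrow> real" where
  "L2_norm_on D f = sqrt (LINT w:D|lborel. (cmod (f w))\<^sup>2)"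

definition bergman_k :: "complex set \<Rightarrow> complex \<Rightarrow> real" where
  "bergman_k D z = Sup {cmod (f z) |f. f \<in> L2_holomorphic D \<and> L2_norm_on D f \<le> 1}"

definition bergman_m :: "complex set \<Rightarrow> complex \<Rightarrow> real" where
  "bergman_m D z =
     Sup {cmod (deriv f z) |f. f \<in> L2_holomorphic D \<and> L2_norm_on D f = 1 \<and> f z = 0}"

definition bergman_metric :: "complex set \<Rightarrow> complex \<Rightarrow> real" where
  "bergman_metric D z = bergman_m D z / bergman_k D z"

text \<open>
  The function \<open>g\<close> is the gradient of \<open>\<rho>\<close>, so \<open>d\<rho> \<noteq> 0\<close> means \<open>g \<noteq> 0\<close>. As the neighbourhood \<open>U\<close>
  may be shrunk, it does not matter whether the Lipschitz condition on \<open>g\<close> is required globally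
  on \<open>U\<close> or only locally, nor whether \<open>g \<noteq> 0\<close> is required on \<open>U\<close> or only at \<open>p\<close>.
\<close>

definition C11_boundary_point :: "complex set \<Rightarrow> complex \<Rightarrow> bool" where
  "C11_boundary_point D p \<longleftrightarrow>
     p \<in> frontier D \<and>
     (\<exists>U (\<rho> :: complex \<Rightarrow> real) (g :: complex \<Rightarrow> complex) L.
        open U \<and> p \<in> U \<and>
        (\<forall>z\<in>U. (\<rho> has_derivative (\<lambda>h. g z \<bullet> h)) (at z)) \<and>
        L-lipschitz_on U g \<and>
        (\<forall>z\<in>U. g z \<noteq> 0) \<and>
        D \<inter> U = {z \<in> U. \<rho> z < 0})"

end

theory Submission
  imports Defs
begin

text \<open>
  Near the boundary point \<open>p\<close> the domain \<open>D\<close> is squeezed between a disc inside it and the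
  exterior of a disc outside it, and for both of these all the metrics are explicit.

  Let \<open>\<delta>\<close> be the distance of \<open>z\<close> to the boundary, and let \<open>q\<close> be a nearest boundary point. A
  \<open>C\<^sup>1\<^sup>,\<^sup>1\<close> boundary has, at every point near \<open>p\<close>, an interior and an exterior tangent disc of
  one and the same radius \<open>r\<close>, and for the discs that are tangent at \<open>q\<close> the point \<open>z\<close> lies on
  the common normal. So \<open>z\<close> is at distance \<open>r - \<delta>\<close> from the centre of a disc \<open>B \<subseteq> D\<close> and at
  distance \<open>r + \<delta>\<close> from the centre of a disc \<open>B'\<close> that misses \<open>D\<close>
  (\<open>C11_tangent_discs_at_nearest_point\<close>). The exterior disc misses all of \<open>D\<close>, not just the part
  of \<open>D\<close> near \<open>p\<close>, because it lies in the neighbourhood in which the defining function describes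
  \<open>D\<close>; so the metrics of \<open>D\<close> can be compared directly with those of the exterior of \<open>B'\<close>.

  Moebius maps give a conformal map \<open>T\<close> of the unit disc onto \<open>B\<close> with \<open>T 0 = z\<close>, and an
  injective holomorphic map \<open>\<psi>\<close> of \<open>D\<close> into the unit disc with \<open>\<psi> z = 0\<close>, namely the
  restriction of a conformal map of the exterior of \<open>B'\<close>. Put \<open>a = \<bar>\<psi>' z\<bar>\<close> and
  \<open>A = 1 / \<bar>T' 0\<bar>\<close>. Each of the extremal problems is monotone under such maps, hence
  (\<open>metrics_sandwich\<close>) the Caratheodory and the Kobayashi metric lie in \<open>[a, A]\<close>, the root
  \<open>k\<close> of the Bergman kernel in \<open>[a, A] / sqrt \<pi>\<close>, and the numerator \<open>m\<close> of the Bergman metric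
  in \<open>sqrt (2 / \<pi>) [a\<^sup>2, A\<^sup>2]\<close>. The two Bergman bounds rest on the fact that
  \<open>f \<mapsto> (f \<circ> T) T'\<close> preserves the \<open>L\<^sup>2\<close> norm (\<open>holomorphic_change_of_variables\<close>), which transports
  the problem to the centre of the unit disc. There the extremal functions are the monomials
  \<open>1\<close> and \<open>w\<close>, of squared norm \<open>\<pi>\<close> and \<open>\<pi> / 2\<close> (\<open>L2_bounds_unit_disc\<close>).

  Finally \<open>a = r / (\<delta> (2 r + \<delta>))\<close> and \<open>A = r / (\<delta> (2 r - \<delta>))\<close> both differ from
  \<open>1 / (2 \<delta>)\<close> by at most \<open>1 / (2 r)\<close>, and \<open>m / k\<close> lies between \<open>sqrt 2 a\<^sup>2 / A\<close> and
  \<open>sqrt 2 A\<^sup>2 / a\<close>, which differ from \<open>sqrt 2 / (2 \<delta>)\<close> by a bounded amount too.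
\<close>

(* The infix $ is to select vector components only, not power series coefficients. *)
unbundle no fps_syntax

section \<open>Change of variables under injective holomorphic maps\<close>

text \<open>
  The change of variables formula with a Jacobian determinant lives on \<open>real^2\<close>. The following
  isomorphism, which preserves Lebesgue measure, carries it over to \<open>complex\<close>.
\<close>

definition plane_map :: "real^2 \<Rightarrow> complex" where
  "plane_map x = Complex (x $ 1) (x $ 2)"

definition plane_inv :: "complex \<Rightarrow> real^2" where
  "plane_inv z = vector [Re z, Im z]"

lemma plane_map_inv [simp]: "plane_map (plane_inv z) = z"
  by (simp add: plane_map_def plane_inv_def)

lemma plane_inv_map [simp]: "plane_inv (plane_map x) = x"
  by (simp add: plane_map_def plane_inv_def vec_eq_iff forall_2)

lemma linear_plane_map: "linear plane_map"
  by (rule linearI) (simp_all add: plane_map_def complex_eq_iff)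

lemma linear_plane_inv: "linear plane_inv"
  by (rule linearI) (simp_all add: plane_inv_def vec_eq_iff forall_2)

lemma borel_plane_map [measurable]: "plane_map \<in> borel \<rightarrow>\<^sub>M borel"
  by (intro borel_measurable_continuous_onI linear_continuous_on linear_plane_map
        linear_conv_bounded_linear[THEN iffD1])

lemma plane_map_vimage_box: "plane_map -` box l u = box (plane_inv l) (plane_inv u)"
  by (auto simp: plane_map_def plane_inv_def in_box_complex_iff mem_box_cart
      forall_2)

lemma lborel_distr_plane_map: "distr lborel borel plane_map = lborel"
proof (rule lborel_eqI[symmetric])
  fix l u :: complex
  assume le0: "\<And>b. b \<in> Basis \<Longrightarrow> l \<bullet> b \<le> u \<bullet> b"
  have le: "Re l \<le> Re u \<and> Im l \<le> Im u"
    using le0[of 1] le0[of \<i>] by (simp add: Basis_complex_def inner_complex_def)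
  have B: "(Basis :: (real^2) set) = {axis 1 1, axis 2 1}"
    by (auto simp: Basis_vec_def UNIV_2)
  have "emeasure (distr lborel borel plane_map) (box l u) =
        emeasure lborel (box (plane_inv l) (plane_inv u))"
    by (simp add: emeasure_distr plane_map_vimage_box)
  also have "\<dots> = ennreal (\<Prod>b\<in>Basis. (plane_inv u - plane_inv l) \<bullet> b)"
    using le by (subst emeasure_lborel_box)
      (auto simp: B inner_axis plane_inv_def)
  also have "(\<Prod>b\<in>Basis. (plane_inv u - plane_inv l) \<bullet> b) = (\<Prod>b\<in>Basis. (u - l) \<bullet> b)"
    by (simp add: B Basis_complex_def inner_complex_def inner_axis plane_inv_def axis_eq_axis
        complex_eq_iff)
  finally show "emeasure (distr lborel borel plane_map) (box l u) = 
      ennreal (\<Prod>b\<in>Basis. (u - l) \<bullet> b)" .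
qed simp

lemma set_integral_plane_map:
  fixes h :: "complex \<Rightarrow> real"
  assumes m: "(\<lambda>w. indicator S w * h w) \<in> borel_measurable borel"
  shows "set_integrable lborel S h \<longleftrightarrow> (\<lambda>x. h (plane_map x)) absolutely_integrable_on (plane_inv ` S)"
    and "(LINT w:S|lborel. h w) = (LINT x:plane_inv ` S|lebesgue. h (plane_map x))"
proof -
  have S: "indicator (plane_inv ` S) x = (indicator S (plane_map x) :: real)" for x
    by (auto simp: indicator_def image_iff) (metis plane_inv_map)
  have m': "(\<lambda>x. indicator S (plane_map x) * h (plane_map x)) \<in> borel_measurable borel"
    using measurable_compose[OF borel_plane_map m] by simp
  show "set_integrable lborel S h \<longleftrightarrow> (\<lambda>x. h (plane_map x)) absolutely_integrable_on (plane_inv ` S)"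
    unfolding set_integrable_def S 
    using m m' by (subst lborel_distr_plane_map[symmetric]) 
      (simp add: integrable_distr_eq integrable_completion)
  show "(LINT w:S|lborel. h w) = (LINT x:plane_inv ` S|lebesgue. h (plane_map x))"
    unfolding set_lebesgue_integral_def S 
    using m m' by (subst lborel_distr_plane_map[symmetric]) 
      (simp add: integral_distr integral_completion)
qed

text \<open>
  Multiplication by \<open>c\<close> is a rotation followed by a dilation with factor \<open>\<bar>c\<bar>\<close>, so it scales areas
  by \<open>\<bar>c\<bar>\<^sup>2\<close>. This is where the factor \<open>\<bar>\<psi>'\<bar>\<^sup>2\<close> in the change of variables comes from.
\<close>

lemma det_plane_mult:
  "det (matrix (\<lambda>v. plane_inv (c * plane_map v))) = (cmod c)\<^sup>2"
  by (simp add: det_2 matrix_def plane_inv_def plane_map_def axis_def cmod_power2)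
     (simp add: power2_eq_square)


text \<open>
  The Jacobian determinant of a holomorphic \<open>\<psi>\<close> is \<open>\<bar>\<psi>'\<bar>\<^sup>2\<close>. Integrability
  passes from the image to \<open>S\<close>, the direction in which the formula is applied: the image is
  a subset of the unit disc with a continuous integrand, or a disc inside the domain of a
  square-integrable function.
\<close>

lemma holomorphic_change_of_variables:
  fixes h :: "complex \<Rightarrow> real"
  assumes "open S" and hol: "\<psi> holomorphic_on S" and inj: "inj_on \<psi> S"
    and h: "set_integrable lborel (\<psi> ` S) h"
  shows "set_integrable lborel S (\<lambda>w. (cmod (deriv \<psi> w))\<^sup>2 * h (\<psi> w))" (is ?A)
    and "(LINT w:S|lborel. (cmod (deriv \<psi> w))\<^sup>2 * h (\<psi> w)) = (LINT w:\<psi> ` S|lborel. h w)" (is ?B)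
proof -
  have mh: "(\<lambda>w. indicator (\<psi> ` S) w * h w) \<in> borel_measurable borel"
    using h by (auto simp: set_integrable_def dest: borel_measurable_integrable)
  have d\<psi>: "deriv \<psi> holomorphic_on S"
    using hol \<open>open S\<close> by (rule holomorphic_deriv)
  have m\<psi>: "(\<lambda>w. indicator S w *\<^sub>R \<psi> w) \<in> borel_measurable borel"
    using \<open>open S\<close> hol by (intro borel_measurable_continuous_on_indicator)
      (auto intro: holomorphic_on_imp_continuous_on)
  have md: "(\<lambda>w. indicator S w *\<^sub>R deriv \<psi> w) \<in> borel_measurable borel"
    using \<open>open S\<close> d\<psi> by (intro borel_measurable_continuous_on_indicator)
      (auto intro: holomorphic_on_imp_continuous_on)
  define f where "f = (\<lambda>w. (cmod (deriv \<psi> w))\<^sup>2 * h (\<psi> w))"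
  have [measurable]: "S \<in> sets borel" using \<open>open S\<close> by simp
  have "(\<lambda>w. indicator S w * f w) = 
     (\<lambda>w. indicator S w * ((cmod (indicator S w *\<^sub>R deriv \<psi> w))\<^sup>2 * (indicator (\<psi> ` S) (indicator S w *\<^sub>R \<psi> w) * h (indicator S w *\<^sub>R \<psi> w))))"
    by (auto simp: f_def fun_eq_iff indicator_def)
  also have "\<dots> \<in> borel_measurable borel"
    by (rule borel_measurable_times[OF _ borel_measurable_times[OF
        borel_measurable_power[OF measurable_compose[OF md borel_measurable_norm]] measurable_compose[OF m\<psi> mh]]]) simp
  finally have mf: "(\<lambda>w. indicator S w * f w) \<in> borel_measurable borel" .

  define g where "g = (\<lambda>x. plane_inv (\<psi> (plane_map x)))"
  define g' where "g' = (\<lambda>x v. plane_inv (deriv \<psi> (plane_map x) * plane_map v))"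
  have img: "g ` (plane_inv ` S) = plane_inv ` (\<psi> ` S)"
    by (auto simp: g_def image_image)
  have "open (plane_inv ` S)"
  proof -
    have "plane_inv ` S = plane_map -` S"
      by (auto simp: image_iff) (metis plane_inv_map)
    moreover have "continuous_on UNIV plane_map"
      using linear_continuous_on linear_plane_map linear_conv_bounded_linear by blast
    ultimately show ?thesis using \<open>open S\<close> by (simp add: open_vimage)
  qed
  then have leb: "plane_inv ` S \<in> sets lebesgue" by simp
  have der: "(g has_derivative g' x) (at x within plane_inv ` S)" if "x \<in> plane_inv ` S" for x
  proof -
    have "plane_map x \<in> S" using that by auto
    then have "(\<psi> has_derivative (*) (deriv \<psi> (plane_map x))) (at (plane_map x))"
      using hol \<open>open S\<close> holomorphic_derivI has_field_derivative_imp_has_derivative by blast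
    then have 1: "((\<lambda>x. \<psi> (plane_map x)) has_derivative (\<lambda>v. deriv \<psi> (plane_map x) * plane_map v)) (at x)"
      by (rule has_derivative_compose[rotated, where f = plane_map and f' = plane_map])
         (use linear_plane_map in \<open>auto intro!: linear_imp_has_derivative\<close>)
    have "(plane_inv has_derivative plane_inv) F" for F
      using linear_plane_inv by (rule linear_imp_has_derivative)
    from has_derivative_compose[OF 1 this] show ?thesis
      unfolding g_def g'_def by (rule has_derivative_at_withinI)
  qed
  have inj': "inj_on g (plane_inv ` S)"
  proof (rule inj_onI)
    fix x y assume "x \<in> plane_inv ` S" "y \<in> plane_inv ` S" "g x = g y"
    then have "plane_map x = plane_map y"
      using inj_onD[OF inj, of "plane_map x" "plane_map y"] by (metis g_def image_iff plane_map_inv)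
    then show "x = y" by (metis plane_inv_map)
  qed
  have gg: "plane_map (g x) = \<psi> (plane_map x)" for x by (simp add: g_def)
  define H where "H = (\<lambda>y. vec (h (plane_map y)) :: real^1)"
  have D: "\<bar>det (matrix (g' x))\<bar> *\<^sub>R H (g x) = vec (f (plane_map x))" for x
    unfolding g'_def det_plane_mult by (simp add: H_def gg f_def vec_eq_iff)
  have ai: "(\<lambda>x. vec (u x) :: real^1) absolutely_integrable_on X \<longleftrightarrow> u absolutely_integrable_on X" for u :: "real^2 \<Rightarrow> real" and X
    by (subst absolutely_integrable_componentwise_iff) (simp add: Basis_vec_def inner_axis)
  have bl: "bounded_linear (vec :: real \<Rightarrow> real^1)"
    by (intro linear_conv_bounded_linear[THEN iffD1] linearI) (simp_all add: vec_eq_iff)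
  have iv: "integral X (\<lambda>x. vec (u x) :: real^1) = vec (integral X u)" if "u absolutely_integrable_on X" for u :: "real^2 \<Rightarrow> real" and X
    using integral_linear[of u X "vec :: real \<Rightarrow> real^1"] that 
    by (simp add: o_def set_lebesgue_integral_eq_integral(1) bl)
  have hh: "(\<lambda>x. h (plane_map x)) absolutely_integrable_on g ` (plane_inv ` S)"
    using set_integral_plane_map(1)[OF mh] h img by simp
  then have "H absolutely_integrable_on g ` (plane_inv ` S)"
    by (simp add: H_def ai)
  with has_absolute_integral_change_of_variables[OF leb der inj', of H]
  have *: "(\<lambda>x. vec (f (plane_map x)) :: real^1) absolutely_integrable_on plane_inv ` S"
    "integral (plane_inv ` S) (\<lambda>x. vec (f (plane_map x)) :: real^1) = integral (g ` (plane_inv ` S)) H"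
    unfolding D by auto
  from *(1) have ff: "(\<lambda>x. f (plane_map x)) absolutely_integrable_on plane_inv ` S"
    by (simp add: ai)
  then show ?A
    using set_integral_plane_map(1)[OF mf] by (simp add: f_def)
  have "integral (plane_inv ` S) (\<lambda>x. f (plane_map x)) = integral (plane_inv ` (\<psi> ` S)) (\<lambda>x. h (plane_map x))"
    using *(2) iv[OF ff] iv[OF hh] by (simp add: H_def img vec_eq_iff)
  moreover have "integral (plane_inv ` S) (\<lambda>x. f (plane_map x)) = (LINT w:S|lborel. f w)"
    using set_integral_plane_map(2)[OF mf] set_lebesgue_integral_eq_integral(2)[OF ff] by simp
  moreover have "integral (plane_inv ` (\<psi> ` S)) (\<lambda>x. h (plane_map x)) = (LINT w:\<psi> ` S|lborel. h w)"
    using set_integral_plane_map(2)[OF mh] set_lebesgue_integral_eq_integral(2)[OF hh[unfolded img]]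
    by simp
  ultimately show ?B by (simp add: f_def)
qed

section \<open>Square-integrable holomorphic functions on the unit disc\<close>

lemma set_integrable_ball_continuous:
  fixes f :: "complex \<Rightarrow> real"
  assumes "continuous_on (cball c s) f"
  shows "set_integrable lborel (ball c s) f"
proof (rule set_integrable_subset)
  show "set_integrable lborel (cball c s) f"
    unfolding set_integrable_def by (rule borel_integrable_compact[OF compact_cball assms])
qed auto

lemma set_integral_mono_subset:
  fixes f :: "'a \<Rightarrow> real"
  assumes "set_integrable M B f" "A \<in> sets M" "A \<subseteq> B" "\<And>x. x \<in> B \<Longrightarrow> 0 \<le> f x"
  shows "(LINT x:A|M. f x) \<le> (LINT x:B|M. f x)"
proof -
  have "set_integrable M A f"
    using assms(1-3) by (rule set_integrable_subset)
  moreover have "indicator A x *\<^sub>R f x \<le> indicator B x *\<^sub>R f x" for x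
    using assms(3,4) by (auto simp: indicator_def)
  ultimately show ?thesis
    using assms(1) unfolding set_lebesgue_integral_def set_integrable_def
    by (intro integral_mono)
qed

lemma set_integral_const_disc:
  assumes "0 \<le> s"
  shows "(LINT w:ball (c::complex) s|lborel. (k::real)) = k * (pi * s\<^sup>2)"
  using assms by (simp add: set_lebesgue_integral_def content_ball unit_ball_vol_2)

lemma set_integral_power2_scale:
  assumes "0 < q"
  shows "(LINT w:ball 0 q|lborel. (cmod w)\<^sup>2) = q ^ 4 * (LINT w:ball 0 1|lborel. (cmod w)\<^sup>2)"
proof -
  define \<psi> where "\<psi> = (\<lambda>w. complex_of_real q * w)"
  have d: "deriv \<psi> w = q" for w
    unfolding \<psi>_def by (simp add: DERIV_imp_deriv[OF DERIV_cmult_Id])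
  have img: "\<psi> ` ball 0 1 = ball 0 q"
  proof -
    have "w \<in> \<psi> ` ball 0 1" if "cmod w < q" for w
      by (rule image_eqI[of _ _ "w / q"]) (use assms that in \<open>auto simp: \<psi>_def norm_divide\<close>)
    with assms show ?thesis by (auto simp: \<psi>_def norm_mult)
  qed
  have "(LINT w:ball 0 q|lborel. (cmod w)\<^sup>2) = (LINT w:ball 0 1|lborel. (cmod (deriv \<psi> w))\<^sup>2 * (cmod (\<psi> w))\<^sup>2)"
    unfolding img[symmetric]
    by (rule holomorphic_change_of_variables(2)[symmetric], unfold img)
       (use assms in \<open>auto simp: \<psi>_def inj_on_def intro!: holomorphic_intros 
          set_integrable_ball_continuous continuous_intros\<close>)
  also have "\<dots> = (LINT w:ball 0 1|lborel. q ^ 4 * (cmod w)\<^sup>2)"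
    unfolding d by (simp add: \<psi>_def norm_mult power_mult_distrib mult.assoc[symmetric] flip: power_add)
  finally show ?thesis by simp
qed

text \<open>
  Dilation shows that an annulus \<open>q \<le> \<bar>w\<bar> < 1\<close> carries the fraction \<open>1 - q\<^sup>4\<close> of the second
  moment \<open>c\<close> of the disc. On the annulus the integrand is between \<open>q\<^sup>2\<close> and \<open>1\<close>, and the area is
  \<open>\<pi> (1 - q\<^sup>2)\<close>. Dividing by \<open>1 - q\<^sup>2\<close> gives \<open>q\<^sup>2 \<pi> \<le> c (1 + q\<^sup>2) \<le> \<pi>\<close>, and \<open>q \<rightarrow> 1\<close> leaves
  only \<open>c = \<pi> / 2\<close>.
\<close>

lemma set_integral_power2_unit_disc:
  "(LINT w:ball (0::complex) 1|lborel. (cmod w)\<^sup>2) = pi / 2"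
proof -
  define c where "c = (LINT w:ball (0::complex) 1|lborel. (cmod w)\<^sup>2)"
  have int: "set_integrable lborel (ball (0::complex) s) (\<lambda>w. (cmod w)\<^sup>2)" for s
    by (intro set_integrable_ball_continuous continuous_intros)
  have intc: "set_integrable lborel (ball (0::complex) s) (\<lambda>w. k::real)" for s k
    by (intro set_integrable_ball_continuous continuous_intros)
  have bounds: "q\<^sup>2 * pi \<le> c * (1 + q\<^sup>2) \<and> c * (1 + q\<^sup>2) \<le> pi" if q: "0 < q" "q < 1" for q :: real
  proof -
    define A where "A = ball (0::complex) 1 - ball 0 q"
    have U: "ball (0::complex) 1 = ball 0 q \<union> A" "ball 0 q \<inter> A = {}"
      using q by (auto simp: A_def)
    have A: "A \<subseteq> ball 0 1" "A \<in> sets lborel" by (auto simp: A_def)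
    note intA = set_integrable_subset[OF int A(2,1)] and intcA = set_integrable_subset[OF intc A(2,1)]
    have "(LINT w:ball 0 q \<union> A|lborel. (cmod w)\<^sup>2) = (LINT w:ball 0 q|lborel. (cmod w)\<^sup>2) + (LINT w:A|lborel. (cmod w)\<^sup>2)"
      by (rule set_integral_Un[OF U(2) int intA])
    then have 1: "(LINT w:A|lborel. (cmod w)\<^sup>2) = c * (1 - q ^ 4)"
      using set_integral_power2_scale[OF q(1)] unfolding U(1)[symmetric] c_def by (simp add: algebra_simps)
    have 2: "(LINT w:A|lborel. k) = k * (pi * (1 - q\<^sup>2))" for k :: real
      using set_integral_Un[OF U(2) intc[of _ k] intcA[of k]] q
      unfolding U(1)[symmetric] by (simp add: set_integral_const_disc algebra_simps)
    have 3: "c * (1 - q ^ 4) \<le> 1 * (pi * (1 - q\<^sup>2))"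
      unfolding 1[symmetric] 2[symmetric]
      by (rule set_integral_mono[OF intA intcA]) (auto simp: A_def abs_square_le_1 power_le_one)
    have 4: "q\<^sup>2 * (pi * (1 - q\<^sup>2)) \<le> c * (1 - q ^ 4)"
      unfolding 1[symmetric] 2[symmetric]
      by (rule set_integral_mono[OF intcA intA]) (use q in \<open>auto simp: A_def intro!: power_mono\<close>)
    have f: "1 - q ^ 4 = (1 + q\<^sup>2) * (1 - q\<^sup>2)"
      by (simp add: algebra_simps flip: power_add)
    have "1 - q\<^sup>2 > 0" using q by (simp add: power_less_one_iff abs_square_less_1)
    with 3 4 show ?thesis unfolding f
      by (metis (no_types, lifting) mult.assoc mult_1 mult_le_cancel_right_pos)
  qed
  have ev: "eventually (\<lambda>q::real. 0 < q \<and> q < 1) (at_left 1)"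
    by (intro eventually_conj eventually_at_left_real eventually_at_left_1) auto
  have "((\<lambda>q::real. c * (1 + q\<^sup>2)) \<longlongrightarrow> c * (1 + 1\<^sup>2)) (at_left 1)"
    by (intro tendsto_intros)
  moreover have "((\<lambda>q::real. q\<^sup>2 * pi) \<longlongrightarrow> 1\<^sup>2 * pi) (at_left 1)"
    by (intro tendsto_intros)
  ultimately have "1\<^sup>2 * pi \<le> c * (1 + 1\<^sup>2)" "c * (1 + 1\<^sup>2) \<le> pi"
    using tendsto_le[OF trivial_limit_at_left_real] tendsto_upperbound[OF _ _ trivial_limit_at_left_real]
      ev bounds by (metis (mono_tags, lifting) eventually_mono)+
  then show ?thesis by (simp add: c_def)
qed

lemma set_integral_rotation:
  fixes h :: "complex \<Rightarrow> real"
  assumes "cmod \<zeta> = 1" and "set_integrable lborel (ball 0 s) h"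
  shows "(LINT w:ball 0 s|lborel. h (\<zeta> * w)) = (LINT w:ball 0 s|lborel. h w)"
proof -
  define \<psi> where "\<psi> = (\<lambda>w. \<zeta> * w)"
  have d: "deriv \<psi> w = \<zeta>" for w
    unfolding \<psi>_def by (simp add: DERIV_imp_deriv[OF DERIV_cmult_Id])
  have [simp]: "\<zeta> \<noteq> 0" using assms by auto
  have img: "\<psi> ` ball 0 s = ball 0 s"
  proof -
    have "w \<in> \<psi> ` ball 0 s" if "cmod w < s" for w
      by (rule image_eqI[of _ _ "w / \<zeta>"]) (use assms that in \<open>auto simp: \<psi>_def norm_divide\<close>)
    with assms show ?thesis by (auto simp: \<psi>_def norm_mult)
  qed
  have "(LINT w:ball 0 s|lborel. (cmod (deriv \<psi> w))\<^sup>2 * h (\<psi> w)) = (LINT w:\<psi> ` ball 0 s|lborel. h w)"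
    by (rule holomorphic_change_of_variables(2), unfold img)
       (use assms in \<open>auto simp: \<psi>_def inj_on_def intro!: holomorphic_intros\<close>)
  then show ?thesis unfolding d img by (simp add: assms(1) \<psi>_def)
qed

text \<open>
  Rotation by \<open>\<theta> = \<pi> / (n - m)\<close> leaves the integral unchanged but changes the sign of the integrand.
  Working with the real part for an arbitrary factor \<open>b\<close> keeps all integrals real.
\<close>

lemma monomials_orthogonal_disc:
  assumes "n \<noteq> m"
  shows "(LINT w:ball 0 s|lborel. Re (b * (w ^ n * cnj w ^ m))) = 0"
proof -
  define \<theta> where "\<theta> = pi / (real n - real m)"
  define \<zeta> where "\<zeta> = cis \<theta>"
  define h where "h = (\<lambda>w. Re (b * (w ^ n * cnj w ^ m)))"
  have "(real n - real m) * \<theta> = pi"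
    using assms by (simp add: \<theta>_def)
  then have "real n * \<theta> - real m * \<theta> = pi"
    by (simp add: left_diff_distrib)
  then have "cis (real n * \<theta>) * cis (- (real m * \<theta>)) = - 1"
    by (simp add: cis_mult)
  then have "\<zeta> ^ n * cnj \<zeta> ^ m = - 1"
    by (simp add: \<zeta>_def Complex.DeMoivre cis_cnj)
  then have "h (\<zeta> * w) = - h w" for w
  proof -
    have "b * ((\<zeta> * w) ^ n * cnj (\<zeta> * w) ^ m) = (\<zeta> ^ n * cnj \<zeta> ^ m) * (b * (w ^ n * cnj w ^ m))"
      by (simp add: power_mult_distrib mult_ac)
    also have "\<dots> = - (b * (w ^ n * cnj w ^ m))"
      unfolding \<open>\<zeta> ^ n * cnj \<zeta> ^ m = - 1\<close> by simp
    finally show ?thesis unfolding h_def by (simp only: uminus_complex.sel)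
  qed
  moreover have "set_integrable lborel (ball 0 s) h"
    unfolding h_def by (intro set_integrable_ball_continuous continuous_intros)
  ultimately have "(LINT w:ball 0 s|lborel. - h w) = (LINT w:ball 0 s|lborel. h w)"
    using set_integral_rotation[of \<zeta> s h] by (simp add: \<zeta>_def)
  then have "(LINT w:ball 0 s|lborel. h w) = 0"
    using set_integral_uminus[OF \<open>set_integrable lborel (ball 0 s) h\<close>] by simp
  then show ?thesis by (simp add: h_def)
qed

text \<open>
  Bessel's inequality for a single Taylor coefficient. With \<open>q = g - a\<^sub>m w\<^sup>m\<close> the function \<open>g\<close> splits
  into \<open>q\<close> and a multiple of the \<open>m\<close>-th monomial, and these are orthogonal because every other term of
  the Taylor series is. Discarding the squared norm of \<open>q\<close> gives the claim. The smaller radius \<open>s < 1\<close>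
  makes the Taylor series converge absolutely and uniformly, as dominated convergence requires.
\<close>

lemma Bessel_disc:
  fixes g :: "complex \<Rightarrow> complex"
  assumes g: "g holomorphic_on ball 0 1" and s: "0 < s" "s < 1"
  defines "a \<equiv> \<lambda>n. (deriv ^^ n) g 0 / fact n"
  shows "(cmod (a m))\<^sup>2 * (LINT w:ball 0 s|lborel. cmod w ^ (2 * m)) \<le> (LINT w:ball 0 s|lborel. (cmod (g w))\<^sup>2)"
proof -
  have sub: "cball 0 s \<subseteq> ball (0::complex) 1" using s by auto
  have cg: "continuous_on (cball 0 s) g"
    using holomorphic_on_imp_continuous_on[OF g] continuous_on_subset sub by blast
  have ser: "(\<lambda>n. a n * w ^ n) sums g w" if "w \<in> ball 0 1" for w
    using holomorphic_power_series[OF g that] by (simp add: a_def)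
  have summ: "summable (\<lambda>n. cmod (a n) * s ^ n)"
  proof -
    have "summable (\<lambda>n. a n * (complex_of_real ((1 + s) / 2)) ^ n)"
      using s by (intro sums_summable[OF ser]) (auto simp: norm_divide simp flip: of_real_add)
    from powser_insidea[OF this, of "of_real s"] s show ?thesis
      by (simp add: norm_mult norm_power norm_divide flip: of_real_add of_real_power)
  qed
  define p where "p = (\<lambda>N w. \<Sum>n\<in>{..<N} - {m}. a n * w ^ n)"
  define q where "q = (\<lambda>w. g w - a m * w ^ m)"
  define L where "L = (\<lambda>f w. Re (cnj (a m) * (f w * cnj w ^ m)))"
  have int_L: "set_integrable lborel (ball 0 s) (L f)" if "continuous_on (cball 0 s) f" for f
    unfolding L_def by (intro set_integrable_ball_continuous continuous_intros that)
  have p0: "(LINT w:ball 0 s|lborel. L (p N) w) = 0" for N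
  proof -
    have "L (p N) w = (\<Sum>n\<in>{..<N} - {m}. Re ((cnj (a m) * a n) * (w ^ n * cnj w ^ m)))" for w
    proof -
      have "cnj (a m) * (p N w * cnj w ^ m) = (\<Sum>n\<in>{..<N} - {m}. (cnj (a m) * a n) * (w ^ n * cnj w ^ m))"
        by (simp only: p_def sum_distrib_left sum_distrib_right mult_ac)
      then show ?thesis by (simp only: L_def Re_sum)
    qed
    then have "(LINT w:ball 0 s|lborel. L (p N) w) =
        (LINT w|lborel. (\<Sum>n\<in>{..<N} - {m}. indicat_real (ball 0 s) w *\<^sub>R Re ((cnj (a m) * a n) * (w ^ n * cnj w ^ m))))"
      by (simp only: set_lebesgue_integral_def scaleR_sum_right)
    also have "\<dots> = (\<Sum>n\<in>{..<N} - {m}. LINT w:ball 0 s|lborel. Re ((cnj (a m) * a n) * (w ^ n * cnj w ^ m)))"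
      unfolding set_lebesgue_integral_def
      by (intro Bochner_Integration.integral_sum set_integrable_ball_continuous[unfolded set_integrable_def] continuous_intros)
    also have "\<dots> = 0"
      by (intro sum.neutral ballI monomials_orthogonal_disc) simp
    finally show ?thesis .
  qed
  have "(\<lambda>N. LINT w:ball 0 s|lborel. L (p N) w) \<longlonglongrightarrow> (LINT w:ball 0 s|lborel. L q w)"
    unfolding set_lebesgue_integral_def
  proof (rule integral_dominated_convergence)
    define K where "K = cmod (a m) * (\<Sum>n. cmod (a n) * s ^ n)"
    show "(\<lambda>w. indicat_real (ball 0 s) w *\<^sub>R L q w) \<in> borel_measurable lborel"
      unfolding q_def by (intro borel_measurable_integrable int_L[unfolded set_integrable_def] continuous_intros cg)
    show "(\<lambda>w. indicat_real (ball 0 s) w *\<^sub>R L (p N) w) \<in> borel_measurable lborel" for N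
      unfolding p_def by (intro borel_measurable_integrable int_L[unfolded set_integrable_def] continuous_intros)
    show "integrable lborel (\<lambda>w::complex. indicat_real (ball 0 s) w * K)"
      using set_integrable_ball_continuous[of 0 s "\<lambda>_. K"] by (simp add: set_integrable_def)
    show "AE w in lborel. (\<lambda>N. indicat_real (ball 0 s) w *\<^sub>R L (p N) w) \<longlonglongrightarrow> indicat_real (ball 0 s) w *\<^sub>R L q w"
    proof (rule AE_I2)
      fix w :: complex
      show "(\<lambda>N. indicat_real (ball 0 s) w *\<^sub>R L (p N) w) \<longlonglongrightarrow> indicat_real (ball 0 s) w *\<^sub>R L q w"
      proof (cases "w \<in> ball 0 s")
        case True
        then have "(\<lambda>N. \<Sum>n<N. a n * w ^ n) \<longlonglongrightarrow> g w"
          using ser[of w] s by (simp add: sums_def)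
        then have "(\<lambda>N. (\<Sum>n<N. a n * w ^ n) - a m * w ^ m) \<longlonglongrightarrow> q w"
          unfolding q_def by (intro tendsto_intros)
        moreover have "eventually (\<lambda>N. (\<Sum>n<N. a n * w ^ n) - a m * w ^ m = p N w) sequentially"
          using eventually_gt_at_top[of m]
          by eventually_elim (simp add: p_def sum_diff1)
        ultimately have "(\<lambda>N. p N w) \<longlonglongrightarrow> q w"
          using filterlim_cong by fast
        then show ?thesis unfolding L_def by (intro tendsto_intros)
      qed simp
    qed
    show "AE w in lborel. norm (indicat_real (ball 0 s) w *\<^sub>R L (p N) w) \<le> indicat_real (ball 0 s) w * K" for N
    proof (rule AE_I2)
      fix w :: complex
      have "\<bar>L (p N) w\<bar> \<le> K" if "cmod w < s"
      proof -
        have "cmod (p N w) \<le> (\<Sum>n\<in>{..<N} - {m}. cmod (a n) * s ^ n)"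
          unfolding p_def using that
          by (intro sum_norm_le) (auto simp: norm_mult norm_power intro!: mult_left_mono power_mono)
        also have "\<dots> \<le> (\<Sum>n. cmod (a n) * s ^ n)"
          using s by (intro sum_le_suminf summ) auto
        finally have 1: "cmod (p N w) \<le> (\<Sum>n. cmod (a n) * s ^ n)" .
        have "\<bar>L (p N) w\<bar> \<le> cmod (cnj (a m) * (p N w * cnj w ^ m))"
          unfolding L_def by (rule abs_Re_le_cmod)
        also have "\<dots> = cmod (a m) * (cmod (p N w) * cmod w ^ m)"
          by (simp add: norm_mult norm_power)
        also have "\<dots> \<le> cmod (a m) * ((\<Sum>n. cmod (a n) * s ^ n) * 1)"
          using 1 that s by (intro mult_left_mono mult_mono power_le_one) (auto intro: order_trans[OF norm_ge_zero])
        finally show ?thesis by (simp add: K_def)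
      qed
      then show "norm (indicat_real (ball 0 s) w *\<^sub>R L (p N) w) \<le> indicat_real (ball 0 s) w * K"
        by (auto simp: indicator_def)
    qed
  qed
  then have q0: "(LINT w:ball 0 s|lborel. L q w) = 0"
    using p0 by (simp add: LIMSEQ_const_iff)
  have int_q: "set_integrable lborel (ball 0 s) (L q)"
    unfolding q_def by (intro int_L continuous_intros cg)
  have int_m: "set_integrable lborel (ball 0 s) (\<lambda>w::complex. k * cmod w ^ (2 * m))" for k
    by (intro set_integrable_ball_continuous continuous_intros)
  have int_g: "set_integrable lborel (ball 0 s) (\<lambda>w::complex. (cmod (g w))\<^sup>2)"
    by (intro set_integrable_ball_continuous continuous_intros cg)
  have int_2q: "set_integrable lborel (ball 0 s) (\<lambda>w. 2 * L q w)"
    using int_q by simp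
  have "(cmod (a m))\<^sup>2 * (LINT w:ball 0 s|lborel. cmod w ^ (2 * m)) 
      = (LINT w:ball 0 s|lborel. 2 * L q w + (cmod (a m))\<^sup>2 * cmod w ^ (2 * m))"
    using set_integral_add(2)[OF int_2q int_m] q0 by simp
  also have "\<dots> \<le> (LINT w:ball 0 s|lborel. (cmod (g w))\<^sup>2)"
  proof (rule set_integral_mono[OF set_integral_add(1)[OF int_2q int_m] int_g])
    fix w :: complex
    have cmod_sq: "(cmod (u + v))\<^sup>2 = (cmod u)\<^sup>2 + (cmod v)\<^sup>2 + 2 * Re (u * cnj v)" for u v
      unfolding cmod_power2 by (simp add: power2_sum algebra_simps)
    have g_eq: "g w = q w + a m * w ^ m" by (simp add: q_def)
    have "(cmod (g w))\<^sup>2 = (cmod (q w))\<^sup>2 + (cmod (a m * w ^ m))\<^sup>2 + 2 * Re (q w * cnj (a m * w ^ m))"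
      unfolding g_eq by (rule cmod_sq)
    also have "Re (q w * cnj (a m * w ^ m)) = L q w"
      by (simp add: L_def mult_ac)
    also have "(cmod (a m * w ^ m))\<^sup>2 = (cmod (a m))\<^sup>2 * cmod w ^ (2 * m)"
      by (simp add: norm_mult norm_power power_mult_distrib mult.commute[of 2] flip: power_mult)
    finally show "2 * L q w + (cmod (a m))\<^sup>2 * cmod w ^ (2 * m) \<le> (cmod (g w))\<^sup>2" by simp
  qed
  finally show ?thesis .
qed

text \<open>
  Both bounds are sharp, with equality for \<open>1\<close> and \<open>w\<close>: they are Bessel's inequality for the first two
  Taylor coefficients, in the limit \<open>s \<rightarrow> 1\<close>.
\<close>

lemma L2_bounds_unit_disc:
  assumes g: "g holomorphic_on ball 0 1" 
    and int: "set_integrable lborel (ball 0 1) (\<lambda>w. (cmod (g w))\<^sup>2)"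
  shows "pi * (cmod (g 0))\<^sup>2 \<le> (LINT w:ball 0 1|lborel. (cmod (g w))\<^sup>2)" (is ?A)
    and "pi / 2 * (cmod (deriv g 0))\<^sup>2 \<le> (LINT w:ball 0 1|lborel. (cmod (g w))\<^sup>2)" (is ?B)
proof -
  let ?I = "LINT w:ball 0 1|lborel. (cmod (g w))\<^sup>2"
  have le: "(LINT w:ball 0 s|lborel. (cmod (g w))\<^sup>2) \<le> ?I" if "s < 1" for s
    using that by (intro set_integral_mono_subset[OF int]) auto
  have ev: "eventually (\<lambda>s::real. 0 < s \<and> s < 1) (at_left 1)"
    by (intro eventually_conj eventually_at_left_real eventually_at_left_1) auto
  have b: "(cmod (g 0))\<^sup>2 * (pi * s\<^sup>2) \<le> ?I" if "0 < s" "s < 1" for s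
    using Bessel_disc[OF g that, of 0] le[OF that(2)] that by (simp add: set_integral_const_disc)
  have e: "eventually (\<lambda>s. (cmod (g 0))\<^sup>2 * (pi * s\<^sup>2) \<le> ?I) (at_left 1)"
    by (rule eventually_mono[OF ev]) (use b in blast)
  have "((\<lambda>s::real. (cmod (g 0))\<^sup>2 * (pi * s\<^sup>2)) \<longlongrightarrow> (cmod (g 0))\<^sup>2 * (pi * 1\<^sup>2)) (at_left 1)"
    by (intro tendsto_intros)
  from this e have "(cmod (g 0))\<^sup>2 * (pi * 1\<^sup>2) \<le> ?I"
    by (rule tendsto_upperbound) simp
  then show ?A by (simp add: mult_ac)
  have b': "(cmod (deriv g 0))\<^sup>2 * (s ^ 4 * (pi / 2)) \<le> ?I" if "0 < s" "s < 1" for s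
  proof -
    have "(cmod (deriv g 0))\<^sup>2 * (LINT w:ball 0 s|lborel. (cmod w)\<^sup>2) \<le> ?I"
      using Bessel_disc[OF g that, of 1] le[OF that(2)] by (simp add: eval_nat_numeral)
    then show ?thesis
      unfolding set_integral_power2_scale[OF that(1)] set_integral_power2_unit_disc .
  qed
  have e: "eventually (\<lambda>s. (cmod (deriv g 0))\<^sup>2 * (s ^ 4 * (pi / 2)) \<le> ?I) (at_left 1)"
    by (rule eventually_mono[OF ev]) (use b' in blast)
  have "((\<lambda>s::real. (cmod (deriv g 0))\<^sup>2 * (s ^ 4 * (pi / 2))) \<longlongrightarrow> (cmod (deriv g 0))\<^sup>2 * (1 ^ 4 * (pi / 2))) (at_left 1)"
    by (intro tendsto_intros)
  from this e have "(cmod (deriv g 0))\<^sup>2 * (1 ^ 4 * (pi / 2)) \<le> ?I"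
    by (rule tendsto_upperbound) simp
  then show ?B by (simp add: mult_ac)
qed

section \<open>Extremal problems between two conformal embeddings\<close>

text \<open>
  Cauchy's estimate on circles of radius \<open>s < 1\<close>, in the limit \<open>s \<rightarrow> 1\<close>.
\<close>

lemma deriv_bound_unit_disc:
  assumes hol: "F holomorphic_on ball 0 1" and sub: "F ` ball 0 1 \<subseteq> ball 0 1"
  shows "cmod (deriv F 0) \<le> 1"
proof (rule field_le_mult_one_interval)
  fix s :: real assume s: "0 < s" "s < 1"
  have "cmod ((deriv ^^ 1) F 0) \<le> fact 1 * 1 / s ^ 1"
  proof (rule Cauchy_inequality)
    have "cball 0 s \<subseteq> ball (0::complex) 1" using s by auto
    then have "F holomorphic_on cball 0 s"
      using hol by (rule holomorphic_on_subset[rotated])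
    then show "F holomorphic_on ball 0 s" "continuous_on (cball 0 s) F"
      by (rule holomorphic_on_subset[OF _ ball_subset_cball], rule holomorphic_on_imp_continuous_on)
    show "cmod (F x) \<le> 1" if "cmod (0 - x) = s" for x
    proof -
      have "F x \<in> ball 0 1"
        using sub by (rule subsetD) (use that s in \<open>auto intro!: imageI\<close>)
      then show ?thesis by simp
    qed
  qed (rule s(1))
  then show "s * cmod (deriv F 0) \<le> 1"
    using s by (simp add: field_simps)
qed

text \<open>
  Applied to a fixed \<open>\<phi>\<close> this bounds the Caratheodory metric from above, applied to a fixed \<open>f\<close> it bounds
  the Kobayashi metric from below. It also contains the comparison of the two metrics.
\<close>

lemma deriv_product_le_1:
  assumes "open D" and f: "f \<in> holomorphic_maps D (ball 0 1)"
    and \<phi>: "\<phi> \<in> holomorphic_maps (ball 0 1) D"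
  shows "cmod (deriv f (\<phi> 0)) * cmod (deriv \<phi> 0) \<le> 1"
proof -
  have hf: "f holomorphic_on D" "f ` D \<subseteq> ball 0 1"
    and h\<phi>: "\<phi> holomorphic_on ball 0 1" "\<phi> ` ball 0 1 \<subseteq> D"
    using f \<phi> by (auto simp: holomorphic_maps_def)
  have "\<phi> 0 \<in> D" using h\<phi>(2) by auto
  then have "deriv (f \<circ> \<phi>) 0 = deriv f (\<phi> 0) * deriv \<phi> 0"
    using hf h\<phi> \<open>open D\<close>
    by (intro deriv_chain holomorphic_on_imp_differentiable_at[of _ "ball 0 1"]
          holomorphic_on_imp_differentiable_at[of _ D]) auto
  moreover have "cmod (deriv (f \<circ> \<phi>) 0) \<le> 1"
    using hf h\<phi> by (intro deriv_bound_unit_disc holomorphic_on_compose_gen[of _ _ _ D]) 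
      (auto simp: image_subset_iff)
  ultimately show ?thesis by (simp add: norm_mult)
qed

lemma L2_norm_nonneg: "0 \<le> L2_norm_on D f"
  unfolding L2_norm_on_def set_lebesgue_integral_def 
  by (intro real_sqrt_ge_zero integral_nonneg_AE AE_I2) simp

lemma L2_norm_power2: "(L2_norm_on D f)\<^sup>2 = (LINT w:D|lborel. (cmod (f w))\<^sup>2)"
proof -
  have "0 \<le> (LINT w:D|lborel. (cmod (f w))\<^sup>2)"
    unfolding set_lebesgue_integral_def by (intro integral_nonneg_AE AE_I2) simp
  then show ?thesis by (simp add: L2_norm_on_def)
qed

text \<open>
  The function \<open>g = (f \<circ> T) T'\<close> on the unit disc has at most the norm of \<open>f\<close> by the change of variables.
  Its value at \<open>0\<close> is \<open>f (T 0) T' 0\<close>, and if \<open>f\<close> vanishes at \<open>T 0\<close>, then the term with \<open>T''\<close> drops out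
  of the product rule and its derivative at \<open>0\<close> is \<open>f' (T 0) (T' 0)\<^sup>2\<close>. So the bounds at the centre of
  the unit disc become bounds at \<open>T 0\<close>.
\<close>

lemma L2_bounds_embedded_disc:
  assumes "open D" and f: "f \<in> L2_holomorphic D"
    and T: "T \<in> holomorphic_maps (ball 0 1) D" and inj: "inj_on T (ball 0 1)"
  shows "sqrt pi * (cmod (f (T 0)) * cmod (deriv T 0)) \<le> L2_norm_on D f"
    and "f (T 0) = 0 \<Longrightarrow> sqrt (pi / 2) * (cmod (deriv f (T 0)) * (cmod (deriv T 0))\<^sup>2) \<le> L2_norm_on D f"
proof -
  let ?B = "ball (0::complex) 1"
  have hf: "f holomorphic_on D" and int: "set_integrable lborel D (\<lambda>w. (cmod (f w))\<^sup>2)"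
    and hT: "T holomorphic_on ?B" "T ` ?B \<subseteq> D"
    using f T by (auto simp: holomorphic_maps_def L2_holomorphic_def)
  have TD: "T 0 \<in> D" using hT(2) by auto
  have fT: "(\<lambda>w. f (T w)) holomorphic_on ?B"
    using holomorphic_on_compose_gen[OF hT(1) hf hT(2)] by (simp add: o_def)
  have dT: "deriv T holomorphic_on ?B"
    using hT(1) by (rule holomorphic_deriv) simp
  define g where "g = (\<lambda>w. f (T w) * deriv T w)"
  have g: "g holomorphic_on ?B"
    unfolding g_def using fT dT by (rule holomorphic_on_mult)
  have g2: "(cmod (g w))\<^sup>2 = (cmod (deriv T w))\<^sup>2 * (cmod (f (T w)))\<^sup>2" for w
    by (simp add: g_def norm_mult power_mult_distrib)
  have "open (T ` ?B)"
    using hT(1) inj by (intro open_mapping_thm3) auto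
  then have TB: "T ` ?B \<in> sets lborel" by simp
  note cv = holomorphic_change_of_variables[OF open_ball hT(1) inj set_integrable_subset[OF int TB hT(2)], folded g2]
  have "(LINT w:?B|lborel. (cmod (g w))\<^sup>2) \<le> (L2_norm_on D f)\<^sup>2"
    unfolding cv(2) L2_norm_power2 by (rule set_integral_mono_subset[OF int TB hT(2)]) simp
  with L2_bounds_unit_disc[OF g cv(1)]
  have b: "pi * (cmod (g 0))\<^sup>2 \<le> (L2_norm_on D f)\<^sup>2" "pi / 2 * (cmod (deriv g 0))\<^sup>2 \<le> (L2_norm_on D f)\<^sup>2"
    by linarith+
  show "sqrt pi * (cmod (f (T 0)) * cmod (deriv T 0)) \<le> L2_norm_on D f"
    by (rule power2_le_imp_le[OF _ L2_norm_nonneg]) 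
       (use b(1) in \<open>simp add: g_def norm_mult power_mult_distrib\<close>)
  assume f0: "f (T 0) = 0"
  have "((\<lambda>w. f (T w)) has_field_derivative deriv f (T 0) * deriv T 0) (at 0)"
    using hf hT TD \<open>open D\<close>
    by (intro DERIV_chain2[where f = f] holomorphic_derivI[of _ D] holomorphic_derivI[of _ ?B]) auto
  from DERIV_mult[OF this holomorphic_derivI[OF dT, of 0]]
  have "deriv g 0 = deriv f (T 0) * deriv T 0 * deriv T 0"
    unfolding g_def by (intro DERIV_imp_deriv) (simp add: f0)
  then have "pi / 2 * (cmod (deriv f (T 0)) * (cmod (deriv T 0))\<^sup>2)\<^sup>2 \<le> (L2_norm_on D f)\<^sup>2"
    using b(2) by (simp add: norm_mult power2_eq_square mult_ac)
  then have "(sqrt (pi / 2) * (cmod (deriv f (T 0)) * (cmod (deriv T 0))\<^sup>2))\<^sup>2 \<le> (L2_norm_on D f)\<^sup>2"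
    by (simp add: power_mult_distrib)
  then show "sqrt (pi / 2) * (cmod (deriv f (T 0)) * (cmod (deriv T 0))\<^sup>2) \<le> L2_norm_on D f"
    by (rule power2_le_imp_le[OF _ L2_norm_nonneg])
qed

text \<open>
  The extremal functions \<open>1\<close> and \<open>w\<close> of the disc, pulled back by \<open>\<psi>\<close>. Their norms can only decrease,
  since \<open>\<psi>\<close> maps \<open>D\<close> injectively into the disc.
\<close>

lemma L2_competitors:
  assumes "open D" and \<psi>: "\<psi> \<in> holomorphic_maps D (ball 0 1)" and inj: "inj_on \<psi> D"
  shows "deriv \<psi> \<in> L2_holomorphic D" and "(L2_norm_on D (deriv \<psi>))\<^sup>2 \<le> pi"
    and "(\<lambda>w. \<psi> w * deriv \<psi> w) \<in> L2_holomorphic D"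
    and "(L2_norm_on D (\<lambda>w. \<psi> w * deriv \<psi> w))\<^sup>2 \<le> pi / 2"
proof -
  let ?B = "ball (0::complex) 1"
  have h: "\<psi> holomorphic_on D" and sub: "\<psi> ` D \<subseteq> ?B"
    using \<psi> by (auto simp: holomorphic_maps_def)
  have d: "deriv \<psi> holomorphic_on D"
    using h \<open>open D\<close> by (rule holomorphic_deriv)
  have "open (\<psi> ` D)"
    using h \<open>open D\<close> inj by (intro open_mapping_thm3)
  then have S: "\<psi> ` D \<in> sets lborel" by simp
  have *: "set_integrable lborel D (\<lambda>w. (cmod (deriv \<psi> w))\<^sup>2 * q (\<psi> w))"
    "(LINT w:D|lborel. (cmod (deriv \<psi> w))\<^sup>2 * q (\<psi> w)) \<le> (LINT w:?B|lborel. q w)"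
    if q: "continuous_on UNIV q" "\<And>w. 0 \<le> q w" for q
  proof -
    have int: "set_integrable lborel ?B q"
      using q(1) by (intro set_integrable_ball_continuous) (rule continuous_on_subset, auto)
    note cv = holomorphic_change_of_variables[OF \<open>open D\<close> h inj set_integrable_subset[OF int S sub]]
    show "set_integrable lborel D (\<lambda>w. (cmod (deriv \<psi> w))\<^sup>2 * q (\<psi> w))"
      by (rule cv(1))
    show "(LINT w:D|lborel. (cmod (deriv \<psi> w))\<^sup>2 * q (\<psi> w)) \<le> (LINT w:?B|lborel. q w)"
      unfolding cv(2) by (rule set_integral_mono_subset[OF int S sub]) (rule q)
  qed
  show "deriv \<psi> \<in> L2_holomorphic D" "(L2_norm_on D (deriv \<psi>))\<^sup>2 \<le> pi"
    unfolding L2_norm_power2 using *[of "\<lambda>_. 1"] d set_integral_const_disc[of 1 0 1]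
    by (auto simp: L2_holomorphic_def)
  have "(cmod (\<psi> w * deriv \<psi> w))\<^sup>2 = (cmod (deriv \<psi> w))\<^sup>2 * (cmod (\<psi> w))\<^sup>2" for w
    by (simp add: norm_mult power_mult_distrib)
  then show "(\<lambda>w. \<psi> w * deriv \<psi> w) \<in> L2_holomorphic D"
    "(L2_norm_on D (\<lambda>w. \<psi> w * deriv \<psi> w))\<^sup>2 \<le> pi / 2"
    unfolding L2_norm_power2 using *[of "\<lambda>w. (cmod w)\<^sup>2"] d h set_integral_power2_unit_disc
    by (auto simp: L2_holomorphic_def intro!: continuous_intros holomorphic_intros)
qed

lemma L2_norm_scale: "L2_norm_on D (\<lambda>w. c * f w) = cmod c * L2_norm_on D f"
  by (simp add: L2_norm_on_def norm_mult power_mult_distrib real_sqrt_mult)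

lemma L2_holomorphic_scale: "f \<in> L2_holomorphic D \<Longrightarrow> (\<lambda>w. c * f w) \<in> L2_holomorphic D"
  by (auto simp: L2_holomorphic_def norm_mult power_mult_distrib intro!: holomorphic_intros)

text \<open>
  Upper bounds come from composing competitors on \<open>D\<close> with \<open>T\<close>, lower bounds from the competitors that
  \<open>\<psi>\<close> provides. The upper bounds are needed for the lower ones as well: a real supremum dominates its
  members only if the set is bounded. Injectivity of \<open>T\<close> and \<open>\<psi>\<close> makes the derivatives nonzero.
\<close>

lemma metrics_sandwich:
  assumes D: "open D" "z \<in> D"
    and \<psi>: "\<psi> \<in> holomorphic_maps D (ball 0 1)" "inj_on \<psi> D" "\<psi> z = 0"
    and T: "T \<in> holomorphic_maps (ball 0 1) D" "inj_on T (ball 0 1)" "T 0 = z"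
  defines "a \<equiv> cmod (deriv \<psi> z)" and "A \<equiv> 1 / cmod (deriv T 0)"
  shows "0 < a"
    and "a \<le> caratheodory_metric D z" "caratheodory_metric D z \<le> A"
    and "a \<le> kobayashi_metric D z" "kobayashi_metric D z \<le> A"
    and "a / sqrt pi \<le> bergman_k D z" "bergman_k D z \<le> A / sqrt pi"
    and "sqrt (2 / pi) * a\<^sup>2 \<le> bergman_m D z" "bergman_m D z \<le> sqrt (2 / pi) * A\<^sup>2"
proof -
  have hT: "T holomorphic_on ball 0 1" and h\<psi>: "\<psi> holomorphic_on D"
    using T \<psi> by (auto simp: holomorphic_maps_def)
  have "deriv T 0 \<noteq> 0"
    using holomorphic_injective_imp_regular[OF hT open_ball T(2), of 0] by simp
  then have T0: "0 < cmod (deriv T 0)" by simp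
  have "deriv \<psi> z \<noteq> 0"
    using holomorphic_injective_imp_regular[OF h\<psi> D(1) \<psi>(2) D(2)] .
  then show a0: "0 < a" by (simp add: a_def)

  have cara: "cmod (deriv f z) \<le> A" if "f \<in> holomorphic_maps D (ball 0 1)" for f
    using deriv_product_le_1[OF D(1) that T(1)] T0 by (simp add: T(3) A_def field_simps)
  show "caratheodory_metric D z \<le> A"
    unfolding caratheodory_metric_def using cara \<psi>(1) by (intro cSUP_least) auto
  show "a \<le> caratheodory_metric D z"
    unfolding caratheodory_metric_def a_def using cara by (intro cSUP_upper \<psi>(1) bdd_aboveI2)

  let ?K = "{cmod t |t. \<exists>\<phi> \<in> holomorphic_maps (ball 0 1) D. \<phi> 0 = z \<and> t * deriv \<phi> 0 = 1}"
  have kob: "a \<le> r" if r: "r \<in> ?K" for r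
  proof -
    obtain t \<phi> where t: "r = cmod t" "\<phi> \<in> holomorphic_maps (ball 0 1) D" "\<phi> 0 = z" "t * deriv \<phi> 0 = 1"
      using r by blast
    have 1: "r * cmod (deriv \<phi> 0) = 1"
      using arg_cong[OF t(4), of cmod] by (simp add: norm_mult t(1))
    have "a * cmod (deriv \<phi> 0) \<le> r * cmod (deriv \<phi> 0)"
      unfolding 1 a_def using deriv_product_le_1[OF D(1) \<psi>(1) t(2)] by (simp add: t(3))
    moreover have "0 < cmod (deriv \<phi> 0)" using t(4) by auto
    ultimately show ?thesis by simp
  qed
  have mem: "A \<in> ?K"
    using T \<open>deriv T 0 \<noteq> 0\<close> by (intro CollectI exI[of _ "1 / deriv T 0"]) (auto simp: A_def norm_divide)
  then show "a \<le> kobayashi_metric D z"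
    unfolding kobayashi_metric_def by (intro cInf_greatest kob) auto
  show "kobayashi_metric D z \<le> A"
    unfolding kobayashi_metric_def by (intro cInf_lower mem bdd_belowI[of _ a] kob)

  note emb = L2_bounds_embedded_disc[OF D(1) _ T(1,2), unfolded T(3)]
  note comp = L2_competitors[OF D(1) \<psi>(1,2)]

  let ?k = "{cmod (f z) |f. f \<in> L2_holomorphic D \<and> L2_norm_on D f \<le> 1}"
  have kup: "r \<le> A / sqrt pi" if r: "r \<in> ?k" for r
  proof -
    obtain f where f: "r = cmod (f z)" "f \<in> L2_holomorphic D" "L2_norm_on D f \<le> 1"
      using r by blast
    then have "sqrt pi * (r * cmod (deriv T 0)) \<le> 1"
      using emb(1)[OF f(2)] by simp
    then show ?thesis using T0 by (simp add: A_def field_simps)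
  qed
  have "L2_norm_on D (deriv \<psi>) \<le> sqrt pi"
    using comp(2) by (rule real_le_rsqrt)
  then have "L2_norm_on D (\<lambda>w. of_real (1 / sqrt pi) * deriv \<psi> w) \<le> 1"
    unfolding L2_norm_scale by (simp add: norm_divide)
  moreover have "cmod (of_real (1 / sqrt pi) * deriv \<psi> z) = a / sqrt pi"
    by (simp add: a_def norm_divide)
  ultimately have kmem: "a / sqrt pi \<in> ?k"
    using L2_holomorphic_scale[OF comp(1), of "of_real (1 / sqrt pi)"] by (metis (mono_tags, lifting) mem_Collect_eq)
  then show "bergman_k D z \<le> A / sqrt pi"
    unfolding bergman_k_def by (intro cSup_least kup) auto
  show "a / sqrt pi \<le> bergman_k D z"
    unfolding bergman_k_def by (intro cSup_upper kmem bdd_aboveI[of _ "A / sqrt pi"] kup)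

  let ?m = "{cmod (deriv f z) |f. f \<in> L2_holomorphic D \<and> L2_norm_on D f = 1 \<and> f z = 0}"
  have mup: "r \<le> sqrt (2 / pi) * A\<^sup>2" if r: "r \<in> ?m" for r
  proof -
    obtain f where f: "r = cmod (deriv f z)" "f \<in> L2_holomorphic D" "L2_norm_on D f = 1" "f z = 0"
      using r by blast
    then have "sqrt (pi / 2) * (r * (cmod (deriv T 0))\<^sup>2) \<le> 1"
      using emb(2)[OF f(2)] by simp
    then show ?thesis using T0 by (simp add: A_def real_sqrt_divide power_divide field_simps)
  qed
  define f where "f = (\<lambda>w. \<psi> w * deriv \<psi> w)"
  have fL: "f \<in> L2_holomorphic D" and fz: "f z = 0"
    using comp(3) \<psi>(3) by (auto simp: f_def)
  have df: "deriv f z = (deriv \<psi> z)\<^sup>2"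
  proof -
    have "(\<psi> has_field_derivative deriv \<psi> z) (at z)"
      by (rule holomorphic_derivI[OF h\<psi> D])
    moreover have "(deriv \<psi> has_field_derivative deriv (deriv \<psi>) z) (at z)"
      by (rule holomorphic_derivI[OF holomorphic_deriv[OF h\<psi> D(1)] D])
    ultimately show ?thesis
      unfolding f_def by (intro DERIV_imp_deriv) 
        (auto intro!: derivative_eq_intros simp: \<psi>(3) power2_eq_square)
  qed
  \<comment> \<open>Competitors for \<open>bergman_m\<close> have norm exactly \<open>1\<close>, so \<open>f\<close> has to be divided by its norm.\<close>
  define n where "n = L2_norm_on D f"
  have "n \<le> sqrt (pi / 2)"
    unfolding n_def f_def using comp(4) by (rule real_le_rsqrt)
  have "0 < sqrt (pi / 2) * (cmod (deriv f z) * (cmod (deriv T 0))\<^sup>2)"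
    using T0 \<open>deriv \<psi> z \<noteq> 0\<close> by (simp add: df norm_power)
  then have "0 < n"
    using emb(2)[OF fL fz] by (simp add: n_def)
  have mmem: "a\<^sup>2 / n \<in> ?m"
  proof (intro CollectI exI conjI)
    show "(\<lambda>w. of_real (1 / n) * f w) \<in> L2_holomorphic D"
      by (rule L2_holomorphic_scale[OF fL])
    show "L2_norm_on D (\<lambda>w. of_real (1 / n) * f w) = 1"
      using \<open>0 < n\<close> unfolding L2_norm_scale n_def[symmetric] by (simp add: norm_divide)
    show "of_real (1 / n) * f z = 0" by (simp add: fz)
    have "f field_differentiable at z"
      using fL D by (auto simp: L2_holomorphic_def holomorphic_on_imp_differentiable_at)
    then have "deriv (\<lambda>w. of_real (1 / n) * f w) z = of_real (1 / n) * deriv f z"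
      by (rule deriv_cmult)
    then show "a\<^sup>2 / n = cmod (deriv (\<lambda>w. of_real (1 / n) * f w) z)"
      using \<open>0 < n\<close> by (simp add: df a_def norm_mult norm_divide norm_power)
  qed
  then show "bergman_m D z \<le> sqrt (2 / pi) * A\<^sup>2"
    unfolding bergman_m_def by (intro cSup_least mup) auto
  have "sqrt (2 / pi) * a\<^sup>2 = a\<^sup>2 / sqrt (pi / 2)"
    by (simp add: real_sqrt_divide)
  also have "\<dots> \<le> a\<^sup>2 / n"
    using \<open>0 < n\<close> \<open>n \<le> sqrt (pi / 2)\<close> by (intro divide_left_mono) auto
  also have "\<dots> \<le> bergman_m D z"
    unfolding bergman_m_def by (intro cSup_upper mmem bdd_aboveI[of _ "sqrt (2 / pi) * A\<^sup>2"] mup)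
  finally show "sqrt (2 / pi) * a\<^sup>2 \<le> bergman_m D z" .
qed

section \<open>Conformal maps of a disc and of the exterior of a disc\<close>

lemma DERIV_Moebius_function:
  assumes "1 - cnj w * z \<noteq> 0"
  shows "(Moebius_function 0 w has_field_derivative (1 - w * cnj w) / (1 - cnj w * z)\<^sup>2) (at z)"
  unfolding Moebius_function_simple[abs_def] using assms
  by (auto intro!: derivative_eq_intros simp: power2_eq_square field_simps)

lemma inj_on_Moebius_function:
  assumes "cmod w < 1"
  shows "inj_on (Moebius_function 0 w) (ball 0 1)"
  using assms by (intro inj_on_inverseI[of _ "Moebius_function 0 (- w)"] Moebius_function_compose) auto

text \<open>
  The centre of the unit disc is sent to the point of the disc with parameter \<open>b = (z - c) / r\<close> by the
  Moebius map with parameter \<open>- b\<close>, whose derivative at \<open>0\<close> is \<open>1 - \<bar>b\<bar>\<^sup>2\<close>.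
\<close>

lemma disc_chart:
  assumes "0 < r" and z: "cmod (z - c) < r"
  obtains T where "T \<in> holomorphic_maps (ball 0 1) (ball c r)" "inj_on T (ball 0 1)" "T 0 = z"
    "cmod (deriv T 0) = (r\<^sup>2 - (cmod (z - c))\<^sup>2) / r"
proof
  define b where "b = (z - c) / r"
  have b: "cmod b < 1" using assms by (simp add: b_def norm_divide)
  then have mb: "cmod (- b) < 1" by simp
  define T where "T = (\<lambda>u. c + r * Moebius_function 0 (- b) u)"
  show "T \<in> holomorphic_maps (ball 0 1) (ball c r)"
  proof -
    have "T holomorphic_on ball 0 1"
      unfolding T_def by (intro holomorphic_intros Moebius_function_holomorphic[OF mb])
    moreover have "T u \<in> ball c r" if "u \<in> ball 0 1" for u
    proof -
      have "dist c (T u) = r * cmod (Moebius_function 0 (- b) u)"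
        using \<open>0 < r\<close> by (simp add: T_def dist_norm norm_mult)
      moreover have "cmod (Moebius_function 0 (- b) u) < 1"
        using that by (intro Moebius_function_norm_lt_1 mb) simp
      ultimately show ?thesis using \<open>0 < r\<close> by simp
    qed
    ultimately show ?thesis by (auto simp: holomorphic_maps_def)
  qed
  show "inj_on T (ball 0 1)"
    using inj_on_Moebius_function[OF mb] \<open>0 < r\<close> by (auto simp: inj_on_def T_def)
  show "T 0 = z"
    using \<open>0 < r\<close> by (simp add: T_def Moebius_function_of_zero b_def)
  have "(T has_field_derivative r * (1 - b * cnj b)) (at 0)"
    unfolding T_def using DERIV_Moebius_function[of "- b" 0]
    by (auto intro!: derivative_eq_intros)
  then have "deriv T 0 = of_real (r * (1 - (cmod b)\<^sup>2))"
    by (simp add: DERIV_imp_deriv complex_norm_square[symmetric] mult.commute flip: of_real_power)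
  then have "cmod (deriv T 0) = \<bar>r * (1 - (cmod b)\<^sup>2)\<bar>"
    by (simp only: norm_of_real)
  also have "\<dots> = r * (1 - (cmod b)\<^sup>2)"
    using \<open>0 < r\<close> b by (intro abs_of_nonneg mult_nonneg_nonneg) (auto simp: power_le_one)
  also have "\<dots> = (r\<^sup>2 - (cmod (z - c))\<^sup>2) / r"
    using \<open>0 < r\<close> by (simp add: b_def norm_divide field_simps power2_eq_square)
  finally show "cmod (deriv T 0) = (r\<^sup>2 - (cmod (z - c))\<^sup>2) / r" .
qed

text \<open>
  The inversion \<open>w \<mapsto> r / (w - c)\<close> maps the exterior of the disc into the unit disc, and a Moebius map then
  moves the image of \<open>z\<close> to \<open>0\<close>.
\<close>

lemma exterior_chart:
  assumes "0 < r" and D: "D \<inter> cball c r = {}" and z: "z \<in> D"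
  obtains \<psi> where "\<psi> \<in> holomorphic_maps D (ball 0 1)" "inj_on \<psi> D" "\<psi> z = 0"
    "cmod (deriv \<psi> z) = r / ((cmod (z - c))\<^sup>2 - r\<^sup>2)"
proof
  define \<iota> where "\<iota> = (\<lambda>w. complex_of_real r / (w - c))"
  have out: "r < cmod (w - c)" if "w \<in> D" for w
    using D that by (auto simp: dist_norm norm_minus_commute not_le)
  have \<iota>: "\<iota> w \<in> ball 0 1" if "w \<in> D" for w
  proof -
    have "0 < cmod (w - c)" using out[OF that] \<open>0 < r\<close> by linarith
    then show ?thesis
      using out[OF that] \<open>0 < r\<close> by (simp add: \<iota>_def norm_divide)
  qed
  have ne: "w - c \<noteq> 0" if "w \<in> D" for w
    using out[OF that] \<open>0 < r\<close> by auto
  define \<alpha> where "\<alpha> = \<iota> z"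
  have \<alpha>: "cmod \<alpha> < 1" using \<iota>[OF z] by (simp add: \<alpha>_def)
  define \<psi> where "\<psi> = (\<lambda>w. Moebius_function 0 \<alpha> (\<iota> w))"
  have hol\<iota>: "\<iota> holomorphic_on D"
    unfolding \<iota>_def using ne by (intro holomorphic_intros) auto
  show "\<psi> \<in> holomorphic_maps D (ball 0 1)"
  proof -
    have "\<iota> ` D \<subseteq> ball 0 1"
      by (intro image_subsetI \<iota>)
    then have "\<psi> holomorphic_on D"
      using holomorphic_on_compose_gen[OF hol\<iota> Moebius_function_holomorphic[OF \<alpha>, of 0]]
      by (simp add: \<psi>_def o_def)
    moreover have "\<psi> w \<in> ball 0 1" if "w \<in> D" for w
      using \<iota>[OF that] Moebius_function_norm_lt_1[OF \<alpha>, of "\<iota> w"] by (simp add: \<psi>_def)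
    ultimately show ?thesis by (auto simp: holomorphic_maps_def)
  qed
  have "inj_on \<iota> D"
    using ne \<open>0 < r\<close> by (auto simp: inj_on_def \<iota>_def field_simps)
  then show "inj_on \<psi> D"
    unfolding \<psi>_def using inj_on_Moebius_function[OF \<alpha>] \<iota> by (auto simp: inj_on_def)
  show "\<psi> z = 0"
    by (simp add: \<psi>_def \<alpha>_def Moebius_function_eq_zero)
  have lt: "(cmod \<alpha>)\<^sup>2 < 1"
    using \<alpha> by (simp add: abs_square_less_1)
  have n\<alpha>: "1 - cnj \<alpha> * \<alpha> = of_real (1 - (cmod \<alpha>)\<^sup>2)"
    by (simp add: complex_norm_square mult.commute flip: of_real_power)
  have ne\<alpha>: "1 - cnj \<alpha> * \<alpha> \<noteq> 0"
    unfolding n\<alpha> using lt by (simp only: of_real_eq_0_iff)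
  have "(\<iota> has_field_derivative - of_real r / (z - c)\<^sup>2) (at z)"
    unfolding \<iota>_def using ne[OF z] by (auto intro!: derivative_eq_intros simp: power2_eq_square)
  from DERIV_chain2[OF DERIV_Moebius_function[of \<alpha> "\<iota> z"] this]
  have "(\<psi> has_field_derivative (1 - \<alpha> * cnj \<alpha>) / (1 - cnj \<alpha> * \<alpha>)\<^sup>2 * (- of_real r / (z - c)\<^sup>2)) (at z)"
    unfolding \<psi>_def \<alpha>_def[symmetric] using ne\<alpha> by simp
  then have "deriv \<psi> z = - of_real r / (z - c)\<^sup>2 / of_real (1 - (cmod \<alpha>)\<^sup>2)"
    using ne\<alpha> unfolding n\<alpha>[symmetric] by (simp add: DERIV_imp_deriv mult.commute[of \<alpha>] power2_eq_square)
  then have "cmod (deriv \<psi> z) = r / (cmod (z - c))\<^sup>2 / (1 - (cmod \<alpha>)\<^sup>2)"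
    using \<open>0 < r\<close> lt by (simp only: norm_divide norm_minus_cancel norm_of_real norm_power abs_of_pos)
  also have "cmod \<alpha> = r / cmod (z - c)"
    using \<open>0 < r\<close> by (simp add: \<alpha>_def \<iota>_def norm_divide)
  also have "r / (cmod (z - c))\<^sup>2 / (1 - (r / cmod (z - c))\<^sup>2) = r / ((cmod (z - c))\<^sup>2 - r\<^sup>2)"
    using ne[OF z] by (simp add: divide_simps) 
  finally show "cmod (deriv \<psi> z) = r / ((cmod (z - c))\<^sup>2 - r\<^sup>2)" .
qed

section \<open>Tangent discs at a \<open>C\<^sup>1\<^sup>,\<^sup>1\<close> boundary point\<close>

text \<open>
  The mean value inequality for \<open>\<rho>\<close> minus its linear part at \<open>q\<close>, whose gradient \<open>g y - g q\<close> is at most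
  \<open>L \<bar>x - q\<bar>\<close> on the segment from \<open>q\<close> to \<open>x\<close>.
\<close>

lemma quadratic_remainder:
  fixes \<rho> :: "complex \<Rightarrow> real"
  assumes V: "convex V"
    and der: "\<And>y. y \<in> V \<Longrightarrow> (\<rho> has_derivative (\<lambda>h. g y \<bullet> h)) (at y)"
    and lip: "L-lipschitz_on V g" and qx: "q \<in> V" "x \<in> V"
  shows "\<bar>\<rho> x - \<rho> q - g q \<bullet> (x - q)\<bar> \<le> L * (norm (x - q))\<^sup>2"
proof -
  define F where "F = (\<lambda>y. \<rho> y - g q \<bullet> y)"
  have seg: "closed_segment q x \<subseteq> V"
    using V qx by (simp add: closed_segment_subset)
  have "0 \<le> L" using lip by (rule lipschitz_on_nonneg)
  have "norm (F x - F q) \<le> (L * norm (x - q)) * norm (x - q)"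
  proof (rule differentiable_bound[OF convex_closed_segment])
    fix y assume y: "y \<in> closed_segment q x"
    then have "y \<in> V" using seg by auto
    show "(F has_derivative (\<lambda>h. (g y - g q) \<bullet> h)) (at y within closed_segment q x)"
      unfolding F_def inner_diff_left
      by (intro derivative_intros has_derivative_at_withinI[OF der] \<open>y \<in> V\<close>)
    have "onorm (\<lambda>h. (g y - g q) \<bullet> h) \<le> norm (g y - g q)"
      by (intro onorm_le) (simp add: Cauchy_Schwarz_ineq2)
    also have "\<dots> \<le> L * norm (y - q)"
      using lipschitz_onD[OF lip \<open>y \<in> V\<close> qx(1)] by (simp add: dist_norm)
    also have "\<dots> \<le> L * norm (x - q)"
      using \<open>0 \<le> L\<close> segment_bound1[OF y] by (simp add: mult_left_mono norm_minus_commute)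
    finally show "onorm (\<lambda>h. (g y - g q) \<bullet> h) \<le> L * norm (x - q)" .
  qed auto
  then show ?thesis by (simp add: F_def inner_diff_right power2_eq_square mult.assoc algebra_simps)
qed

text \<open>
  Let \<open>h = x - q\<close>. Membership of \<open>x\<close> in the tangent disc on the side \<open>\<sigma>\<close> says
  \<open>\<bar>h\<bar>\<^sup>2 < 2 r \<sigma> (\<nu> \<bullet> h)\<close> with the unit normal \<open>\<nu>\<close>. So the linear part \<open>\<sigma> (g \<bullet> h)\<close> exceeds
  \<open>\<bar>g\<bar> \<bar>h\<bar>\<^sup>2 / (2 r)\<close> and beats the quadratic error once \<open>r\<close> is small compared with \<open>\<bar>g\<bar> / L\<close>.
  The sign \<open>\<sigma>\<close> treats the interior and the exterior disc at once.
\<close>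

lemma tangent_ball_sign:
  fixes \<rho> :: "complex \<Rightarrow> real" and \<sigma> :: real
  assumes "0 < r" "g \<noteq> 0" "2 * r * L \<le> norm g"
    and rem: "\<bar>\<rho> x - g \<bullet> (x - q)\<bar> \<le> L * (norm (x - q))\<^sup>2"
    and \<sigma>: "\<sigma> = 1 \<or> \<sigma> = -1"
    and x: "norm (x - (q + (\<sigma> * r) *\<^sub>R sgn g)) < r"
  shows "0 < \<sigma> * \<rho> x"
proof -
  define h where "h = x - q"
  have "(norm (h - (\<sigma> * r) *\<^sub>R sgn g))\<^sup>2 < r\<^sup>2"
    using x \<open>0 < r\<close> by (intro power_strict_mono) (auto simp: h_def algebra_simps)
  also have "(norm (h - (\<sigma> * r) *\<^sub>R sgn g))\<^sup>2 = (norm h)\<^sup>2 - 2 * r * (\<sigma> * (sgn g \<bullet> h)) + r\<^sup>2"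
  proof -
    have "(norm (h - (\<sigma> * r) *\<^sub>R sgn g))\<^sup>2 = 
       (norm h)\<^sup>2 + (norm ((\<sigma> * r) *\<^sub>R sgn g))\<^sup>2 - 2 * (h \<bullet> ((\<sigma> * r) *\<^sub>R sgn g))"
      by (simp only: power2_norm_eq_inner inner_diff_left inner_diff_right inner_commute)
    also have "(norm ((\<sigma> * r) *\<^sub>R sgn g))\<^sup>2 = r\<^sup>2"
      using \<sigma> \<open>g \<noteq> 0\<close> by (auto simp: norm_sgn power_mult_distrib)
    finally show ?thesis by (simp add: inner_commute algebra_simps)
  qed
  finally have 1: "(norm h)\<^sup>2 < 2 * r * (\<sigma> * (sgn g \<bullet> h))" by simp
  have "2 * r * (L * (norm h)\<^sup>2) \<le> norm g * (norm h)\<^sup>2"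
    using mult_right_mono[OF assms(3), of "(norm h)\<^sup>2"] by (simp add: mult_ac)
  also have "\<dots> < norm g * (2 * r * (\<sigma> * (sgn g \<bullet> h)))"
    using 1 \<open>g \<noteq> 0\<close> by simp
  also have "\<dots> = 2 * r * (\<sigma> * (g \<bullet> h))"
    using \<open>g \<noteq> 0\<close> by (simp add: sgn_div_norm)
  finally have "L * (norm h)\<^sup>2 < \<sigma> * (g \<bullet> h)" using \<open>0 < r\<close> by simp
  moreover have "\<sigma> * (g \<bullet> h) - L * (norm h)\<^sup>2 \<le> \<sigma> * \<rho> x"
    using rem \<sigma> by (auto simp: h_def abs_le_iff)
  ultimately show ?thesis by linarith
qed

lemma defining_function_zero_on_frontier:
  fixes \<rho> :: "complex \<Rightarrow> real"
  assumes "open D" "open U" "q \<in> U" "q \<in> frontier D" and DU: "D \<inter> U = {z \<in> U. \<rho> z < 0}"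
    and cont: "isCont \<rho> q"
  shows "\<rho> q = 0"
proof (rule antisym)
  have "q \<notin> D"
    using assms(1,4) by (simp add: frontier_def interior_open)
  show "0 \<le> \<rho> q"
  proof (rule ccontr)
    assume "\<not> 0 \<le> \<rho> q"
    then have "q \<in> D \<inter> U" unfolding DU using \<open>q \<in> U\<close> by simp
    with \<open>q \<notin> D\<close> show False by simp
  qed
  show "\<rho> q \<le> 0"
  proof (rule ccontr)
    assume "\<not> \<rho> q \<le> 0"
    moreover have "(\<rho> \<longlongrightarrow> \<rho> q) (nhds q)"
      using cont by (simp add: isCont_def tendsto_at_iff_tendsto_nhds)
    ultimately have "eventually (\<lambda>y. 0 < \<rho> y) (nhds q)"
      by (intro order_tendstoD(1)[of \<rho> "\<rho> q"]) simp_all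
    moreover have "eventually (\<lambda>y. y \<in> U) (nhds q)"
      using assms by (intro eventually_nhds_in_open)
    ultimately have "eventually (\<lambda>y. y \<notin> D) (nhds q)"
    proof eventually_elim
      case (elim y)
      show "y \<notin> D"
      proof
        assume "y \<in> D"
        then have "y \<in> {z \<in> U. \<rho> z < 0}"
          unfolding DU[symmetric] using elim by (intro IntI)
        with elim show False by simp
      qed
    qed
    then obtain S where S: "open S" "q \<in> S" "\<forall>y\<in>S. y \<notin> D"
      unfolding eventually_nhds by (elim exE conjE)
    then have "S \<inter> D = {}" by blast
    then have "S \<inter> closure D = {}"
      using open_Int_closure_eq_empty[OF S(1)] by simp
    then show False
      using S(2) \<open>q \<in> frontier D\<close> by (auto simp: frontier_def)
  qed
qed

lemma dist_ge_of_disjoint_balls: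
  fixes x y :: complex
  assumes "ball x r \<inter> ball y s = {}" "0 < r" "0 < s"
  shows "r + s \<le> dist x y"
proof (rule ccontr)
  assume "\<not> r + s \<le> dist x y"
  then have lt: "norm (y - x) < r + s" by (simp add: dist_norm norm_minus_commute)
  define t where "t = r / (r + s)"
  define w where "w = x + t *\<^sub>R (y - x)"
  have "x - w = - (t *\<^sub>R (y - x))" by (simp add: w_def)
  then have "dist x w = t * norm (y - x)"
    using assms by (simp add: dist_norm t_def)
  also have "\<dots> < r"
    using mult_strict_left_mono[OF lt \<open>0 < r\<close>] assms by (simp add: t_def field_simps)
  finally have 1: "w \<in> ball x r" by simp
  have "y - w = (1 - t) *\<^sub>R (y - x)"
    by (simp add: w_def algebra_simps)
  moreover have "1 - t = s / (r + s)" using assms by (simp add: t_def field_simps)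
  ultimately have "dist y w = s / (r + s) * norm (y - x)"
    using assms by (simp add: dist_norm)
  also have "\<dots> < s"
    using mult_strict_left_mono[OF lt \<open>0 < s\<close>] assms by (simp add: field_simps)
  finally have "w \<in> ball y s" by simp
  with 1 assms(1) show False by blast
qed

text \<open>
  The radius can be chosen uniformly because near \<open>p\<close> the gradient stays at least half as long as at \<open>p\<close>,
  and the discs stay in the neighbourhood of \<open>p\<close> on which \<open>\<rho>\<close> is defined.
\<close>

lemma C11_tangent_balls:
  assumes "open D" and C: "C11_boundary_point D p"
  obtains r \<eta> where "0 < r" "0 < \<eta>"
    "\<And>q. q \<in> frontier D \<Longrightarrow> dist q p < \<eta> \<Longrightarrow>
       \<exists>\<nu>. norm \<nu> = 1 \<and> ball (q - r *\<^sub>R \<nu>) r \<subseteq> D \<and> D \<inter> ball (q + r *\<^sub>R \<nu>) r = {}"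
proof -
  from C obtain U \<rho> g L where U: "open U" "p \<in> U"
    and der: "\<And>z. z \<in> U \<Longrightarrow> (\<rho> has_derivative (\<lambda>h. g z \<bullet> h)) (at z)"
    and lip: "L-lipschitz_on U g" and g0: "\<And>z. z \<in> U \<Longrightarrow> g z \<noteq> 0"
    and DU: "D \<inter> U = {z \<in> U. \<rho> z < 0}"
    unfolding C11_boundary_point_def by blast
  obtain e where e: "0 < e" "ball p e \<subseteq> U"
    using U openE by blast
  define G where "G = norm (g p)"
  have G: "0 < G" using g0 U by (simp add: G_def)
  have L: "0 \<le> L" using lip by (rule lipschitz_on_nonneg)
  \<comment> \<open>A point of a tangent disc at \<open>q\<close> is closer than \<open>2 r + \<eta> \<le> e\<close> to \<open>p\<close>. The other entries of
    the minima give \<open>L \<eta> \<le> G / 2\<close>, hence \<open>\<bar>g q\<bar> \<ge> G / 2\<close>, and \<open>2 r L \<le> G / 2\<close>;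
    \<open>L + 1\<close> replaces \<open>L\<close> because \<open>L\<close> may be \<open>0\<close>.\<close>
  define r where "r = min (e / 4) (G / (4 * (L + 1)))"
  define \<eta> where "\<eta> = min (e / 2) (G / (2 * (L + 1)))"
  have r: "0 < r" "r \<le> e / 4" and \<eta>: "0 < \<eta>" "\<eta> \<le> e / 2"
    using e G L by (simp_all only: r_def \<eta>_def min.cobounded1) simp_all
  have "r * (4 * (L + 1)) \<le> G" "\<eta> * (2 * (L + 1)) \<le> G"
    using L by (auto simp: r_def \<eta>_def simp flip: pos_le_divide_eq)
  then have rL: "4 * (r * L) \<le> G" and \<eta>L: "2 * (\<eta> * L) \<le> G"
    using r(1) \<eta>(1) by (simp_all add: algebra_simps)
  show ?thesis
  proof (rule that[OF r(1) \<eta>(1)])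
    fix q assume q: "q \<in> frontier D" "dist q p < \<eta>"
    have qe: "q \<in> ball p e" using q(2) \<eta> e by (simp add: dist_commute)
    then have qU: "q \<in> U" using e by auto
    have "isCont \<rho> q"
      using der[OF qU] by (rule has_derivative_continuous)
    then have \<rho>q: "\<rho> q = 0"
      by (rule defining_function_zero_on_frontier[OF \<open>open D\<close> U(1) qU q(1) DU])
    have "norm (g q - g p) \<le> L * dist q p"
      using lipschitz_onD[OF lip qU U(2)] by (simp add: dist_norm)
    also have "\<dots> \<le> L * \<eta>"
      using q(2) L by (intro mult_left_mono) auto
    finally have "norm (g q - g p) \<le> G / 2" using \<eta>L by (simp add: mult.commute)
    then have "G / 2 \<le> norm (g q)"
      using norm_triangle_ineq2[of "g p" "g q"] by (simp add: G_def norm_minus_commute)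
    then have gq: "2 * r * L \<le> norm (g q)" using rL by simp
    define \<nu> where "\<nu> = sgn (g q)"
    have \<nu>: "norm \<nu> = 1" using g0[OF qU] by (simp add: \<nu>_def norm_sgn)
    have sgn: "x \<in> U \<and> 0 < \<sigma> * \<rho> x" if \<sigma>: "\<sigma> = 1 \<or> \<sigma> = -1" and x: "x \<in> ball (q + (\<sigma> * r) *\<^sub>R \<nu>) r" for x \<sigma>
    proof -
      have x': "norm (x - (q + (\<sigma> * r) *\<^sub>R \<nu>)) < r"
        using x by (simp add: dist_norm norm_minus_commute)
      have "norm (x - q) \<le> norm (x - (q + (\<sigma> * r) *\<^sub>R \<nu>)) + norm ((\<sigma> * r) *\<^sub>R \<nu>)"
        using norm_triangle_ineq[of "x - (q + (\<sigma> * r) *\<^sub>R \<nu>)" "(\<sigma> * r) *\<^sub>R \<nu>"] by simp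
      also have "norm ((\<sigma> * r) *\<^sub>R \<nu>) = r" using \<sigma> \<nu> r by auto
      finally have "norm (x - q) < 2 * r" using x' by simp
      then have "dist x p < e"
        using dist_triangle[of x p q] q(2) r \<eta> by (simp add: dist_norm)
      then have xe: "x \<in> ball p e" by (simp add: dist_commute)
      have "\<bar>\<rho> x - \<rho> q - g q \<bullet> (x - q)\<bar> \<le> L * (norm (x - q))\<^sup>2"
        using e(2) by (intro quadratic_remainder[OF convex_ball _ lipschitz_on_subset[OF lip e(2)] qe xe] der) auto
      then have "0 < \<sigma> * \<rho> x"
        using tangent_ball_sign[OF r(1) g0[OF qU] gq _ \<sigma> x'[unfolded \<nu>_def]] by (simp add: \<rho>q)
      then show ?thesis using xe e(2) by auto
    qed
    have "ball (q - r *\<^sub>R \<nu>) r \<subseteq> D"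
      using sgn[of "-1"] DU by auto
    moreover have "D \<inter> ball (q + r *\<^sub>R \<nu>) r = {}"
    proof (rule ccontr)
      assume "D \<inter> ball (q + r *\<^sub>R \<nu>) r \<noteq> {}"
      then obtain x where x: "x \<in> D" "x \<in> ball (q + r *\<^sub>R \<nu>) r" by blast
      with sgn[of 1 x] have "x \<in> U" "0 < \<rho> x" by simp_all
      moreover have "x \<in> {z \<in> U. \<rho> z < 0}"
        unfolding DU[symmetric] using x(1) \<open>x \<in> U\<close> by (rule IntI)
      ultimately show False by simp
    qed
    ultimately show "\<exists>\<nu>. norm \<nu> = 1 \<and> ball (q - r *\<^sub>R \<nu>) r \<subseteq> D \<and> D \<inter> ball (q + r *\<^sub>R \<nu>) r = {}"
      using \<nu> by blast
  qed
qed

text \<open>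
  Let \<open>q\<close> be a boundary point nearest to \<open>z\<close>. The disc of radius \<open>\<delta>\<close> about \<open>z\<close> lies in \<open>D\<close> and hence is
  disjoint from the exterior tangent disc at \<open>q\<close>, so the centres are at least \<open>\<delta> + r\<close> apart. As \<open>q\<close> is at
  distance \<open>\<delta>\<close> from one centre and \<open>r\<close> from the other, the triangle inequality is an equality. This puts
  \<open>z\<close> on the normal at \<open>q\<close>, and the distances to both centres follow.
\<close>

lemma C11_tangent_discs_at_nearest_point:
  assumes "open D" and C: "C11_boundary_point D p"
  obtains r \<eta> where "0 < r" "0 < \<eta>"
    "\<And>z. z \<in> D \<Longrightarrow> dist z p < \<eta> \<Longrightarrow>
       0 < boundary_dist D z \<and> boundary_dist D z < r \<and>
       (\<exists>c. ball c r \<subseteq> D \<and> cmod (z - c) = r - boundary_dist D z) \<and>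
       (\<exists>c. D \<inter> cball c r = {} \<and> cmod (z - c) = r + boundary_dist D z)"
proof -
  obtain r \<eta> where r: "0 < r" and \<eta>: "0 < \<eta>" and balls:
    "\<And>q. q \<in> frontier D \<Longrightarrow> dist q p < \<eta> \<Longrightarrow>
       \<exists>\<nu>. norm \<nu> = 1 \<and> ball (q - r *\<^sub>R \<nu>) r \<subseteq> D \<and> D \<inter> ball (q + r *\<^sub>R \<nu>) r = {}"
    using C11_tangent_balls[OF assms] by blast
  have p: "p \<in> frontier D" using C by (simp add: C11_boundary_point_def)
  show ?thesis
    \<comment> \<open>The bound \<open>r\<close> ensures \<open>\<delta> < r\<close>. Since \<open>q\<close> may be twice as far from \<open>p\<close> as \<open>z\<close> is, \<open>\<eta>\<close> is halved.\<close>
  proof (rule that[of r "min r (\<eta> / 2)"])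
    fix z assume z: "z \<in> D" and zp: "dist z p < min r (\<eta> / 2)"
    define \<delta> where "\<delta> = boundary_dist D z"
    have "z \<notin> frontier D"
      using z \<open>open D\<close> by (simp add: frontier_def interior_open)
    then have "\<delta> > 0"
      using infdist_pos_not_in_closed[of "frontier D" z] p by (auto simp: \<delta>_def boundary_dist_def)
    have "\<delta> \<le> dist z p"
      unfolding \<delta>_def boundary_dist_def using p by (rule infdist_le)
    obtain q where q: "q \<in> frontier D" "dist z q = \<delta>"
    proof -
      have "frontier D \<noteq> {}" using p by blast
      then obtain q where "q \<in> frontier D" "infdist z (frontier D) = dist z q"
        using infdist_attains_inf[OF frontier_closed] by blast
      then show ?thesis using that by (simp add: \<delta>_def boundary_dist_def)
    qed
    have "dist q p < \<eta>"
      using dist_triangle[of q p z] q(2) \<open>\<delta> \<le> dist z p\<close> zp by (simp add: dist_commute)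
    then obtain \<nu> where \<nu>: "norm \<nu> = 1" and int: "ball (q - r *\<^sub>R \<nu>) r \<subseteq> D"
      and ext: "D \<inter> ball (q + r *\<^sub>R \<nu>) r = {}"
      using balls[OF q(1)] by blast
    have "ball z \<delta> \<inter> frontier D = {}"
    proof -
      have "\<delta> \<le> dist z y" if "y \<in> frontier D" for y
        unfolding \<delta>_def boundary_dist_def using that by (rule infdist_le)
      then show ?thesis by (meson disjoint_iff mem_ball not_le)
    qed
    then have "ball z \<delta> \<subseteq> D"
      using connected_Int_frontier[OF connected_ball, of z \<delta> D] z \<open>0 < \<delta>\<close> centre_in_ball by blast
    then have "ball z \<delta> \<inter> ball (q + r *\<^sub>R \<nu>) r = {}"
      using ext by auto
    then have ge: "\<delta> + r \<le> norm (z - (q + r *\<^sub>R \<nu>))"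
      using dist_ge_of_disjoint_balls[OF _ \<open>0 < \<delta>\<close> r] by (simp add: dist_norm)
    have n: "norm (z - q) = \<delta>" "norm (- (r *\<^sub>R \<nu>)) = r"
      using q(2) \<nu> r by (simp_all add: dist_norm)
    have sum: "z - (q + r *\<^sub>R \<nu>) = (z - q) + (- (r *\<^sub>R \<nu>))" by simp
    have eq: "norm ((z - q) + (- (r *\<^sub>R \<nu>))) = norm (z - q) + norm (- (r *\<^sub>R \<nu>))"
      using ge norm_triangle_ineq[of "z - q" "- (r *\<^sub>R \<nu>)"] unfolding sum n by linarith
    have "\<delta> *\<^sub>R (- (r *\<^sub>R \<nu>)) = r *\<^sub>R (z - q)"
      using norm_triangle_eq[THEN iffD1, OF eq] unfolding n .
    then have "r *\<^sub>R (z - q) = r *\<^sub>R (- (\<delta> *\<^sub>R \<nu>))"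
      by (simp add: mult.commute)
    then have zq: "z - q = - (\<delta> *\<^sub>R \<nu>)"
      by (rule scaleR_left_imp_eq[rotated]) (use r in simp)
    have "\<delta> < r" using \<open>\<delta> \<le> dist z p\<close> zp by simp
    have "z - (q - r *\<^sub>R \<nu>) = (r - \<delta>) *\<^sub>R \<nu>"
      using zq by (simp add: algebra_simps)
    then have ci: "cmod (z - (q - r *\<^sub>R \<nu>)) = r - \<delta>"
      using \<nu> \<open>\<delta> < r\<close> by simp
    have De: "D \<inter> cball (q + r *\<^sub>R \<nu>) r = {}"
      using ext open_Int_closure_eq_empty[OF \<open>open D\<close>, of "ball (q + r *\<^sub>R \<nu>) r"] r by simp
    have ce: "cmod (z - (q + r *\<^sub>R \<nu>)) = r + \<delta>"
      using eq unfolding sum n by simp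
    show "0 < boundary_dist D z \<and> boundary_dist D z < r \<and>
       (\<exists>c. ball c r \<subseteq> D \<and> cmod (z - c) = r - boundary_dist D z) \<and>
       (\<exists>c. D \<inter> cball c r = {} \<and> cmod (z - c) = r + boundary_dist D z)"
      unfolding \<delta>_def[symmetric]
      by (intro conjI exI) (rule \<open>0 < \<delta>\<close> \<open>\<delta> < r\<close> int ci De ce)+
  qed (use r \<eta> in auto)
qed

section \<open>Boundary asymptotics of the metrics\<close>

text \<open>
  Here \<open>s\<close> is \<open>1 / (2 \<delta>)\<close>. The quotient lies between \<open>sqrt 2 a\<^sup>2 / A = sqrt 2 (a - (a / A) (A - a))\<close> and
  \<open>sqrt 2 A\<^sup>2 / a = sqrt 2 (A + (A / a) (A - a))\<close>. As \<open>A - a \<le> 2 C\<close> and \<open>A / a \<le> 3\<close>, the corrections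
  are at most \<open>6 C\<close>; with the error \<open>C\<close> of \<open>a\<close> and \<open>A\<close> themselves this makes \<open>7 C\<close>.
\<close>

lemma bergman_ratio_estimate:
  fixes a A k m s C :: real
  assumes a: "0 < a" "s - C \<le> a" "a \<le> A" "A \<le> s + C" "A \<le> 3 * a"
    and k: "a / sqrt pi \<le> k" "k \<le> A / sqrt pi"
    and m: "sqrt (2 / pi) * a\<^sup>2 \<le> m" "m \<le> sqrt (2 / pi) * A\<^sup>2"
  shows "\<bar>m / k - sqrt 2 * s\<bar> \<le> sqrt 2 * (7 * C)"
proof -
  have A: "0 < A" and C: "0 \<le> C" using a by auto
  have k0: "0 < k" using k(1) a by (smt (verit) divide_pos_pos pi_gt_zero real_sqrt_gt_0_iff)
  have sq: "sqrt (2 / pi) = sqrt 2 / sqrt pi" by (rule real_sqrt_divide)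
  have "m / k \<le> (sqrt (2 / pi) * A\<^sup>2) / (a / sqrt pi)"
    using m k a by (intro frac_le) auto
  also have "\<dots> = sqrt 2 * (A + A / a * (A - a))"
    unfolding sq using a by (simp add: field_simps power2_eq_square)
  also have "\<dots> \<le> sqrt 2 * (s + C + 3 * (2 * C))"
    using a A C by (intro mult_left_mono add_mono mult_mono) (auto simp: field_simps)
  finally have up: "m / k \<le> sqrt 2 * (s + 7 * C)" by (simp add: add.commute)
  have "a / A * (A - a) \<le> 1 * (2 * C)"
    using a A by (intro mult_mono) auto
  then have "s - 7 * C \<le> a - a / A * (A - a)"
    using a C by simp
  then have "sqrt 2 * (s - 7 * C) \<le> sqrt 2 * (a - a / A * (A - a))"
    by (intro mult_left_mono) auto
  also have "\<dots> = (sqrt (2 / pi) * a\<^sup>2) / (A / sqrt pi)"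
    unfolding sq using A by (simp add: field_simps power2_eq_square)
  also have "\<dots> \<le> m / k"
    using m k a k0 by (intro frac_le) (auto intro: order_trans[OF _ m(1)])
  finally have "sqrt 2 * (s - 7 * C) \<le> m / k" .
  with up show ?thesis by (simp add: abs_le_iff algebra_simps)
qed

lemma Limsup_bounded_finite:
  fixes f :: "'a \<Rightarrow> real"
  assumes "eventually P F" and "\<And>x. P x \<Longrightarrow> f x \<le> M"
  shows "Limsup F (\<lambda>x. ereal (f x)) < \<infinity>"
proof -
  have "Limsup F (\<lambda>x. ereal (f x)) \<le> ereal M"
    by (rule Limsup_bounded) (rule eventually_mono[OF assms(1)], simp add: assms(2))
  also have "\<dots> < \<infinity>" by simp
  finally show ?thesis .
qed

text \<open>
  All bounds depend on the common radius \<open>r\<close> only, not on \<open>\<delta>\<close>. This is what the limit needs.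
\<close>

lemma metrics_between_tangent_discs:
  assumes "open D" "z \<in> D" and \<delta>: "0 < \<delta>" "\<delta> < r"
    and int: "ball c r \<subseteq> D" "cmod (z - c) = r - \<delta>"
    and ext: "D \<inter> cball c' r = {}" "cmod (z - c') = r + \<delta>"
  shows "\<bar>caratheodory_metric D z - 1 / (2 * \<delta>)\<bar> \<le> 1 / (2 * r)"
    and "\<bar>kobayashi_metric D z - 1 / (2 * \<delta>)\<bar> \<le> 1 / (2 * r)"
    and "\<bar>bergman_metric D z - 1 / (sqrt 2 * \<delta>)\<bar> \<le> sqrt 2 * (7 * (1 / (2 * r)))"
    and "\<bar>bergman_k D z - 1 / (2 * sqrt pi * \<delta>)\<bar> \<le> 1 / (2 * r)"
proof -
  have r: "0 < r" using \<delta> by simp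
  have "cmod (z - c) < r" using int(2) \<delta> by simp
  from disc_chart[OF r this] obtain T where T: "T \<in> holomorphic_maps (ball 0 1) (ball c r)"
    "inj_on T (ball 0 1)" "T 0 = z" and dT: "cmod (deriv T 0) = (r\<^sup>2 - (r - \<delta>)\<^sup>2) / r"
    unfolding int(2) by blast
  have T': "T \<in> holomorphic_maps (ball 0 1) D"
    using T(1) int(1) by (auto simp: holomorphic_maps_def)
  from exterior_chart[OF r ext(1) \<open>z \<in> D\<close>] obtain \<psi> where \<psi>: "\<psi> \<in> holomorphic_maps D (ball 0 1)"
    "inj_on \<psi> D" "\<psi> z = 0" and d\<psi>: "cmod (deriv \<psi> z) = r / ((r + \<delta>)\<^sup>2 - r\<^sup>2)"
    unfolding ext(2) by blast
  define a where "a = cmod (deriv \<psi> z)"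
  define A where "A = 1 / cmod (deriv T 0)"
  note sandwich = metrics_sandwich[OF \<open>open D\<close> \<open>z \<in> D\<close> \<psi> T' T(2,3), folded a_def A_def]
  have a: "a = r / (\<delta> * (2 * r + \<delta>))"
    unfolding a_def d\<psi> by (simp add: power2_eq_square algebra_simps)
  have A: "A = r / (\<delta> * (2 * r - \<delta>))"
    unfolding A_def dT by (simp add: power2_eq_square algebra_simps)
  define s where "s = 1 / (2 * \<delta>)"
  define C where "C = 1 / (2 * r)"
  have C: "0 < C" using r by (simp add: C_def)
  have "s - a = 1 / (2 * (2 * r + \<delta>))"
    using \<delta> r by (simp add: a s_def divide_simps)
  also have "\<dots> \<le> C"
    unfolding C_def using \<delta> r by (intro divide_left_mono) auto
  finally have sa: "s - C \<le> a" by simp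
  have "A - s = 1 / (2 * (2 * r - \<delta>))"
    using \<delta> r by (simp add: A s_def divide_simps)
  also have "\<dots> \<le> C"
    unfolding C_def using \<delta> r by (intro divide_left_mono) auto
  finally have As: "A \<le> s + C" by simp
  have aA: "a \<le> A"
    using sandwich(2,3) by simp
  have "A \<le> r / (\<delta> * ((2 * r + \<delta>) / 3))"
    unfolding A using \<delta> r by (intro divide_left_mono mult_left_mono) auto
  also have "\<dots> = 3 * a" unfolding a by simp
  finally have A3: "A \<le> 3 * a" .
  show "\<bar>caratheodory_metric D z - 1 / (2 * \<delta>)\<bar> \<le> 1 / (2 * r)"
    "\<bar>kobayashi_metric D z - 1 / (2 * \<delta>)\<bar> \<le> 1 / (2 * r)"
    using sandwich(2-5) sa As unfolding s_def[symmetric] C_def[symmetric] by linarith+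
  have "2 / sqrt 2 = sqrt 2"
    by (rule real_div_sqrt) simp
  moreover have "1 / (sqrt 2 * \<delta>) = (2 / sqrt 2) * s"
    by (simp add: s_def)
  ultimately have "1 / (sqrt 2 * \<delta>) = sqrt 2 * s"
    by simp
  then show "\<bar>bergman_metric D z - 1 / (sqrt 2 * \<delta>)\<bar> \<le> sqrt 2 * (7 * (1 / (2 * r)))"
    unfolding bergman_metric_def C_def[symmetric]
    using bergman_ratio_estimate[OF sandwich(1) sa aA As A3 sandwich(6-9)] by simp
  have sp: "1 \<le> sqrt pi" using pi_gt3 by (intro real_le_rsqrt) simp
  have "bergman_k D z \<le> (s + C) / sqrt pi"
    using sandwich(7) divide_right_mono[OF As, of "sqrt pi"] by simp
  moreover have "(s - C) / sqrt pi \<le> bergman_k D z"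
    using sandwich(6) divide_right_mono[OF sa, of "sqrt pi"] by simp
  moreover have "C / sqrt pi \<le> C"
    using C sp by (simp add: field_simps)
  ultimately have "\<bar>bergman_k D z - s / sqrt pi\<bar> \<le> C"
    by (simp add: add_divide_distrib diff_divide_distrib)
  then show "\<bar>bergman_k D z - 1 / (2 * sqrt pi * \<delta>)\<bar> \<le> 1 / (2 * r)"
    by (simp add: s_def C_def mult_ac)
qed

theorem proposition10:
  fixes D :: "complex set" and p :: complex
  assumes "open D" and "connected D" and "D \<noteq> {}"
    and "C11_boundary_point D p"
  shows "Limsup (at p within D)
           (\<lambda>z. ereal \<bar>caratheodory_metric D z - 1 / (2 * boundary_dist D z)\<bar>) < \<infinity> \<and>
         Limsup (at p within D)
           (\<lambda>z. ereal \<bar>kobayashi_metric D z - 1 / (2 * boundary_dist D z)\<bar>) < \<infinity> \<and>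
         Limsup (at p within D)
           (\<lambda>z. ereal \<bar>bergman_metric D z - 1 / (sqrt 2 * boundary_dist D z)\<bar>) < \<infinity> \<and>
         Limsup (at p within D)
           (\<lambda>z. ereal \<bar>bergman_k D z - 1 / (2 * sqrt pi * boundary_dist D z)\<bar>) < \<infinity>"
proof -
  obtain r \<eta> where r: "0 < r" and \<eta>: "0 < \<eta>" and discs:
    "\<And>z. z \<in> D \<Longrightarrow> dist z p < \<eta> \<Longrightarrow>
       0 < boundary_dist D z \<and> boundary_dist D z < r \<and>
       (\<exists>c. ball c r \<subseteq> D \<and> cmod (z - c) = r - boundary_dist D z) \<and>
       (\<exists>c. D \<inter> cball c r = {} \<and> cmod (z - c) = r + boundary_dist D z)"
    by (rule C11_tangent_discs_at_nearest_point[OF \<open>open D\<close> \<open>C11_boundary_point D p\<close>]) (rule that)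
  have near: "eventually (\<lambda>z. z \<in> D \<and> dist z p < \<eta>) (at p within D)"
    using \<eta> by (auto simp: eventually_at)
  have bounds:
    "\<bar>caratheodory_metric D z - 1 / (2 * boundary_dist D z)\<bar> \<le> 1 / (2 * r)"
    "\<bar>kobayashi_metric D z - 1 / (2 * boundary_dist D z)\<bar> \<le> 1 / (2 * r)"
    "\<bar>bergman_metric D z - 1 / (sqrt 2 * boundary_dist D z)\<bar> \<le> sqrt 2 * (7 * (1 / (2 * r)))"
    "\<bar>bergman_k D z - 1 / (2 * sqrt pi * boundary_dist D z)\<bar> \<le> 1 / (2 * r)"
    if z: "z \<in> D \<and> dist z p < \<eta>" for z
  proof -
    have z': "z \<in> D" "dist z p < \<eta>" using z by simp_all
    obtain c c' where "0 < boundary_dist D z" "boundary_dist D z < r"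
      "ball c r \<subseteq> D" "cmod (z - c) = r - boundary_dist D z"
      "D \<inter> cball c' r = {}" "cmod (z - c') = r + boundary_dist D z"
      using discs[OF z'] by (elim conjE exE) (rule that)
    from metrics_between_tangent_discs[OF \<open>open D\<close> z'(1) this]
    show "\<bar>caratheodory_metric D z - 1 / (2 * boundary_dist D z)\<bar> \<le> 1 / (2 * r)"
      "\<bar>kobayashi_metric D z - 1 / (2 * boundary_dist D z)\<bar> \<le> 1 / (2 * r)"
      "\<bar>bergman_metric D z - 1 / (sqrt 2 * boundary_dist D z)\<bar> \<le> sqrt 2 * (7 * (1 / (2 * r)))"
      "\<bar>bergman_k D z - 1 / (2 * sqrt pi * boundary_dist D z)\<bar> \<le> 1 / (2 * r)" .
  qed
  show ?thesis
    by (intro conjI; rule Limsup_bounded_finite[OF near]; rule bounds; assumption)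
qed

end
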